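(* The membership problem for $\mathsf{CT}^{\mathsf{core}}_{I,\forall}$ (given an instance $I$ and a finite set $\Sigma$ of tgds, decide whether the core chase with $\Sigma$ on $I$ terminates) is $\mathsf{RE}$-complete.
   Context: Let $\mathsf{Cons}$ (constants), $\mathsf{Nulls}$ (nulls) and $\mathsf{Vars}$ (variables) be pairwise disjoint countably infinite sets. A schema is a finite set of relation symbols with positive arities. An instance is a finite set of atoms $R(a_1,\dots,a_k)$ with $a_i\in\mathsf{Cons}\cup\mathsf{Nulls}$. A homomorphism from an instance $I$ to an instance $J$ is a map between the sets of constants and nulls occurring in them that is the identity on constants and satisfies $h(I)\subseteq J$; an endomorphism of $I$ is a homomorphism from $I$ to $I$. A core of $I$ is a subset $I'\subseteq I$ such that some endomorphism $h$ has $h(I)\subseteq I'$ and no endomorphism $g$ has $g(I')\subsetneq I'$; cores are unique up to isomorphism. A tgd $\xi=\alpha\to\beta$ is a sentence $\forall\bar x,\bar y\,(\alpha(\bar x,\bar y)\to\exists\bar z\,\beta(\bar x,\bar z))$, with body $\alpha$ and head $\beta$ conjunctions of relational atoms over variables and constants (the body may be empty). A trigger for $\Sigma$ on $I$ is a pair $(\xi,h)$ with $\xi=\alpha\to\beta\in\Sigma$ and $h$ a mapping of the universal variables of $\xi$ to $\mathsf{Cons}\cup\mathsf{Nulls}$ (identity on constants) with $h(\alpha)\subseteq I$. It is active on $I$ if no extension $h'$ of $h$ satisfies $h'(\beta)\subseteq I$. Firing it transforms $I$ into $I\cup h'(\beta)$, where $h'$ extends $h$ by assigning new fresh nulls to the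 existential variables. The core chase sequence with $\Sigma$ on $I$ is $I=I_0,I_1,I_2,\dots$, where $I_{i+1}$ is obtained from $I_i$ by firing all triggers active on $I_i$ in parallel and taking the core of the union of the results. It terminates if some $I_i$ has no active trigger. $\mathsf{CT}^{\mathsf{core}}_{I,\forall}$ is the class of finite sets $\Sigma$ of tgds such that the core chase with $\Sigma$ on $I$ terminates. $\mathsf{RE}$ is the class of recursively enumerable sets. *)

theory Defs
  imports Main "HOL-Library.Nat_Bijection"
begin

section \<open>Recursively enumerable sets and many-one completeness\<close>

datatype recf =
    Zero
  | Succ
  | Proj nat
  | Comp recf "recf list"
  | PrimRec recf recf
  | Mu recf

text \<open>
  \<open>computes f xs y\<close>: the partial recursive function denoted by \<open>f\<close> is defined on the
  argument list \<open>xs\<close>, with value \<open>y\<close>. Arities are not tracked: a term applied to an argument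
  list that fits none of the rules is undefined there. In \<open>Mu\<close>, all values below the least zero have to be defined (and nonzero).
\<close>

inductive computes :: "recf \<Rightarrow> nat list \<Rightarrow> nat \<Rightarrow> bool" where
  zero: "computes Zero xs 0"
| succ: "computes Succ [x] (Suc x)"
| proj: "i < length xs \<Longrightarrow> computes (Proj i) xs (xs ! i)"
| comp: "list_all2 (\<lambda>g y. computes g xs y) gs ys \<Longrightarrow> computes f ys z \<Longrightarrow>
    computes (Comp f gs) xs z"
| primrec_0: "computes f xs y \<Longrightarrow> computes (PrimRec f g) (0 # xs) y"
| primrec_Suc: "computes (PrimRec f g) (n # xs) y \<Longrightarrow> computes g (n # y # xs) z \<Longrightarrow>
    computes (PrimRec f g) (Suc n # xs) z"
| mu: "computes f (n # xs) 0 \<Longrightarrow> (\<forall>i<n. \<exists>v. computes f (i # xs) (Suc v)) \<Longrightarrow>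
    computes (Mu f) xs n"

definition total_recursive :: "(nat \<Rightarrow> nat) \<Rightarrow> bool" where
  "total_recursive g \<longleftrightarrow> (\<exists>f. \<forall>x. computes f [x] (g x))"

definition recursively_enumerable :: "nat set \<Rightarrow> bool" where
  "recursively_enumerable A \<longleftrightarrow> (\<exists>f. A = {x. \<exists>y. computes f [x] y})"

definition many_one_reducible :: "nat set \<Rightarrow> nat set \<Rightarrow> bool" where
  "many_one_reducible A B \<longleftrightarrow> (\<exists>g. total_recursive g \<and> (\<forall>x. x \<in> A \<longleftrightarrow> g x \<in> B))"

definition RE_complete :: "nat set \<Rightarrow> bool" where
  "RE_complete A \<longleftrightarrow> recursively_enumerable A \<and>
     (\<forall>B. recursively_enumerable B \<longrightarrow> many_one_reducible B A)"


section \<open>Instances, homomorphisms and cores\<close>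

datatype val = Const nat | Null nat

datatype 'a atom = Atom (rel: nat) (args: "'a list")

type_synonym fact = "val atom"

definition vals :: "fact set \<Rightarrow> val set" where
  "vals I = (\<Union>a\<in>I. set_atom a)"

text \<open>
  Only the restriction of \<open>h\<close> to \<open>vals I\<close> matters; that it maps into \<open>vals J\<close> follows from
  the inclusion.
\<close>

definition homomorphism :: "(val \<Rightarrow> val) \<Rightarrow> fact set \<Rightarrow> fact set \<Rightarrow> bool" where
  "homomorphism h I J \<longleftrightarrow>
     (\<forall>c. Const c \<in> vals I \<longrightarrow> h (Const c) = Const c) \<and> map_atom h ` I \<subseteq> J"

abbreviation endomorphism :: "(val \<Rightarrow> val) \<Rightarrow> fact set \<Rightarrow> bool" where
  "endomorphism h I \<equiv> homomorphism h I I"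

definition is_core :: "fact set \<Rightarrow> fact set \<Rightarrow> bool" where
  "is_core I' I \<longleftrightarrow> I' \<subseteq> I \<and>
     (\<exists>h. endomorphism h I \<and> map_atom h ` I \<subseteq> I') \<and>
     (\<nexists>g. endomorphism g I' \<and> map_atom g ` I' \<subset> I')"


section \<open>Tuple-generating dependencies and the core chase\<close>

datatype trm = Var nat | Cst nat

datatype tgd = Tgd (body: "trm atom list") (head: "trm atom list")

definition vars :: "trm atom list \<Rightarrow> nat set" where
  "vars as = {x. \<exists>a\<in>set as. Var x \<in> set_atom a}"

definition uvars :: "tgd \<Rightarrow> nat set" where
  "uvars \<xi> = vars (body \<xi>)"

definition evars :: "tgd \<Rightarrow> nat set" where
  "evars \<xi> = vars (head \<xi>) - vars (body \<xi>)"

fun val_of :: "(nat \<rightharpoonup> val) \<Rightarrow> trm \<Rightarrow> val" where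
  "val_of h (Var x) = the (h x)"
| "val_of h (Cst c) = Const c"

definition facts_of :: "(nat \<rightharpoonup> val) \<Rightarrow> trm atom list \<Rightarrow> fact set" where
  "facts_of h as = map_atom (val_of h) ` set as"

text \<open>
  Variable assignments are partial maps whose domain is exactly the relevant set of variables,
  so that an instance has only finitely many triggers.
\<close>

type_synonym trigger = "tgd \<times> (nat \<rightharpoonup> val)"

definition triggers :: "tgd set \<Rightarrow> fact set \<Rightarrow> trigger set" where
  "triggers \<Sigma> I = {(\<xi>, h). \<xi> \<in> \<Sigma> \<and> dom h = uvars \<xi> \<and> facts_of h (body \<xi>) \<subseteq> I}"

definition active_triggers :: "tgd set \<Rightarrow> fact set \<Rightarrow> trigger set" where
  "active_triggers \<Sigma> I = {(\<xi>, h) \<in> triggers \<Sigma> I.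
     \<not> (\<exists>h'. h \<subseteq>\<^sub>m h' \<and> dom h' = uvars \<xi> \<union> evars \<xi> \<and> facts_of h' (head \<xi>) \<subseteq> I)}"

text \<open>
  The nulls introduced by all the active triggers are chosen at once: \<open>\<nu> t z\<close> is the index
  of the null that firing \<open>t\<close> assigns to its existential variable \<open>z\<close>.
\<close>

definition fresh_nulls :: "fact set \<Rightarrow> trigger set \<Rightarrow> (trigger \<Rightarrow> nat \<Rightarrow> nat) \<Rightarrow> bool" where
  "fresh_nulls I T \<nu> \<longleftrightarrow>
     inj_on (\<lambda>(t, z). \<nu> t z) (SIGMA t:T. evars (fst t)) \<and>
     (\<forall>t\<in>T. \<forall>z\<in>evars (fst t). Null (\<nu> t z) \<notin> vals I)"

fun fire :: "(trigger \<Rightarrow> nat \<Rightarrow> nat) \<Rightarrow> trigger \<Rightarrow> fact set \<Rightarrow> fact set" where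
  "fire \<nu> (\<xi>, h) I =
     I \<union> facts_of (\<lambda>z. if z \<in> evars \<xi> then Some (Null (\<nu> (\<xi>, h) z)) else h z) (head \<xi>)"

text \<open>The additional \<open>I\<close> in the union only matters if no trigger is active.\<close>

definition core_chase_step :: "tgd set \<Rightarrow> fact set \<Rightarrow> fact set \<Rightarrow> bool" where
  "core_chase_step \<Sigma> I J \<longleftrightarrow> (\<exists>\<nu>. fresh_nulls I (active_triggers \<Sigma> I) \<nu> \<and>
     is_core J (I \<union> (\<Union>t\<in>active_triggers \<Sigma> I. fire \<nu> t I)))"

definition core_chase_sequence :: "tgd set \<Rightarrow> fact set \<Rightarrow> (nat \<Rightarrow> fact set) \<Rightarrow> bool" where
  "core_chase_sequence \<Sigma> I s \<longleftrightarrow> s 0 = I \<and> (\<forall>i. core_chase_step \<Sigma> (s i) (s (Suc i)))"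

text \<open>
  Sequences are determined by \<open>\<Sigma>\<close> and \<open>I\<close> only up to isomorphism (choice of nulls and of
  cores); termination is required for each of them.
\<close>

definition core_chase_terminates :: "tgd set \<Rightarrow> fact set \<Rightarrow> bool" where
  "core_chase_terminates \<Sigma> I \<longleftrightarrow>
     (\<forall>s. core_chase_sequence \<Sigma> I s \<longrightarrow> (\<exists>i. active_triggers \<Sigma> (s i) = {}))"


section \<open>The membership problem\<close>

definition schema :: "(nat \<rightharpoonup> nat) \<Rightarrow> bool" where
  "schema S \<longleftrightarrow> finite (dom S) \<and> (\<forall>k\<in>ran S. 0 < k)"

definition atom_over :: "(nat \<rightharpoonup> nat) \<Rightarrow> 'a atom \<Rightarrow> bool" where
  "atom_over S a \<longleftrightarrow> S (rel a) = Some (length (args a))"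

definition instance_over :: "(nat \<rightharpoonup> nat) \<Rightarrow> fact set \<Rightarrow> bool" where
  "instance_over S I \<longleftrightarrow> finite I \<and> (\<forall>a\<in>I. atom_over S a)"

definition tgd_over :: "(nat \<rightharpoonup> nat) \<Rightarrow> tgd \<Rightarrow> bool" where
  "tgd_over S \<xi> \<longleftrightarrow> head \<xi> \<noteq> [] \<and> (\<forall>a\<in>set (body \<xi>) \<union> set (head \<xi>). atom_over S a)"

definition CT_core :: "(nat \<rightharpoonup> nat) \<Rightarrow> fact set \<Rightarrow> tgd set set" where
  "CT_core S I = {\<Sigma>. finite \<Sigma> \<and> (\<forall>\<xi>\<in>\<Sigma>. tgd_over S \<xi>) \<and> core_chase_terminates \<Sigma> I}"

fun val_encode :: "val \<Rightarrow> nat" where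
  "val_encode (Const n) = sum_encode (Inl n)"
| "val_encode (Null n) = sum_encode (Inr n)"

fun trm_encode :: "trm \<Rightarrow> nat" where
  "trm_encode (Var n) = sum_encode (Inl n)"
| "trm_encode (Cst n) = sum_encode (Inr n)"

definition atom_encode :: "('a \<Rightarrow> nat) \<Rightarrow> 'a atom \<Rightarrow> nat" where
  "atom_encode e a = prod_encode (rel a, list_encode (map e (args a)))"

definition tgd_encode :: "tgd \<Rightarrow> nat" where
  "tgd_encode \<xi> = prod_encode
     (list_encode (map (atom_encode trm_encode) (body \<xi>)),
      list_encode (map (atom_encode trm_encode) (head \<xi>)))"

definition input_encode :: "fact set \<times> tgd set \<Rightarrow> nat" where
  "input_encode = (\<lambda>(I, \<Sigma>). prod_encode
     (set_encode (atom_encode val_encode ` I), set_encode (tgd_encode ` \<Sigma>)))"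

definition CT_core_membership :: "nat set" where
  "CT_core_membership =
     {input_encode (I, \<Sigma>) | S I \<Sigma>. schema S \<and> instance_over S I \<and> \<Sigma> \<in> CT_core S I}"

lemma inj_val_encode: "inj val_encode"
proof (rule injI)
  fix x y assume "val_encode x = val_encode y"
  then show "x = y" by (cases x; cases y) (auto dest: injD [OF inj_sum_encode])
qed

lemma inj_trm_encode: "inj trm_encode"
proof (rule injI)
  fix x y assume "trm_encode x = trm_encode y"
  then show "x = y" by (cases x; cases y) (auto dest: injD [OF inj_sum_encode])
qed

lemma inj_atom_encode:
  assumes "inj e"
  shows "inj (atom_encode e)"
proof (rule injI)
  fix a b assume "atom_encode e a = atom_encode e b"
  then show "a = b"
    using assms by (cases a; cases b) (auto simp: atom_encode_def list_encode_eq inj_map_eq_map)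
qed

lemma inj_tgd_encode: "inj tgd_encode"
proof (rule injI)
  fix a b assume "tgd_encode a = tgd_encode b"
  then show "a = b"
    by (cases a; cases b)
      (auto simp: tgd_encode_def list_encode_eq inj_map_eq_map [OF inj_atom_encode [OF inj_trm_encode]])
qed

lemma inj_on_input_encode: "inj_on input_encode {(I, \<Sigma>). finite I \<and> finite \<Sigma>}"
proof (rule inj_onI)
  fix p q
  assume p: "p \<in> {(I, \<Sigma>). finite I \<and> finite \<Sigma>}" and q: "q \<in> {(I, \<Sigma>). finite I \<and> finite \<Sigma>}"
    and eq: "input_encode p = input_encode q"
  obtain I \<Sigma> J T where pq: "p = (I, \<Sigma>)" "q = (J, T)" by fastforce
  have "atom_encode val_encode ` I = atom_encode val_encode ` J" "tgd_encode ` \<Sigma> = tgd_encode ` T"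
    using p q eq by (auto simp: pq input_encode_def set_encode_eq)
  then show "p = q"
    by (simp add: pq inj_image_eq_iff [OF inj_atom_encode [OF inj_val_encode]]
        inj_image_eq_iff [OF inj_tgd_encode])
qed

end

theory Submission
  imports Defs "HOL-Library.Countable"
begin

text \<open>
  Chase steps preserve homomorphisms, so up to homomorphic equivalence the core chase agrees with
  the chase that never takes cores. Hence it terminates iff some finite model \<open>M\<close> of \<open>\<Sigma>\<close>
  satisfies \<open>I \<rightarrow> M \<rightarrow> J\<close> for an instance \<open>J\<close> obtained from \<open>I\<close> by firing triggers; such an \<open>M\<close>
  is a certificate that can be checked, which gives recursive enumerability.

  For hardness, the inductive definition of \<open>computes\<close> is read as a Datalog program over numbers,
  and the only existential rule creates successors. If the computation halts, further rules derive
  all facts over the constants of the input, and these facts form a finite model. If it diverges,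
  all derived facts are true in the standard model of arithmetic, and a finite model \<open>M\<close> with
  \<open>I \<rightarrow> M \<rightarrow> J\<close> would map there, although its successor chain has to be infinite.
\<close>

section \<open>Computable functions on coded types\<close>

text \<open>A finite model above \<open>I\<close> alone certifies nothing: for
  \<open>R(x,y) -> exists z. R(y,z)\<close> and one edge between two constants, a loop closes off a
  finite model while the core chase grows a path forever. The second homomorphism makes
  \<open>M\<close> as general as the chase itself. Taking cores then turns equivalence with
  \<open>M\<close> into termination, because satisfaction of heads can be carried back from
  \<open>M\<close> to a finite core.

  In the reduction the difficult case is that of halting, since the successor rule keeps firing
  whatever the computation does. The remedy is to make the distinction between numbers worthless:
  once a result is found, every number up to the input becomes, among other things, its own
  successor, and the endless chain of nulls folds onto the constants. Without such a collapse
  nothing can fold the chain, because it starts at 0 and homomorphisms fix constants. The tgds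
  depend only on the recursive function; its argument enters only through the instance.\<close>

lemma computes_fun:
  assumes "computes f xs y" "computes f xs z"
  shows "y = z"
  using assms
proof (induction arbitrary: z)
  case (comp xs gs ys f y)
  from comp.prems obtain ys' where
    ys': "list_all2 (\<lambda>g y. computes g xs y) gs ys'" "computes f ys' z"
    by (cases) auto
  have "ys = ys'"
  proof (rule nth_equalityI)
    show "length ys = length ys'"
      using comp.IH(1) ys'(1) by (simp add: list_all2_conv_all_nth)
    show "ys ! i = ys' ! i" if "i < length ys" for i
      using comp.IH(1) ys'(1) that by (auto simp: list_all2_conv_all_nth)
  qed
  then show ?case using comp.IH(2) ys'(2) by blast
next
  case (primrec_Suc f g n xs y w)
  from primrec_Suc.prems show ?case
    by (cases) (use primrec_Suc.IH in blast)
next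
  case (mu f n xs)
  from mu.prems obtain
    z: "computes f (z # xs) 0" "\<forall>i<z. \<exists>v. computes f (i # xs) (Suc v)"
    by (cases) auto
  show ?case
  proof (rule linorder_cases [of n z])
    assume "n < z"
    then show ?thesis using z(2) mu.IH(1) by fastforce
  next
    assume "z < n"
    then show ?thesis using z(1) mu.IH(2) by fastforce
  qed
next
  case (zero xs)
  then show ?case by cases auto
next
  case (succ x)
  then show ?case by cases auto
next
  case (proj i xs)
  from proj.prems show ?case by cases auto
next
  case (primrec_0 f xs y g)
  from primrec_0.prems show ?case
    by cases (use primrec_0.IH in auto)
qed

lemma computes_Proj: "i < length xs \<Longrightarrow> y = xs ! i \<Longrightarrow> computes (Proj i) xs y"
  by (simp add: computes.proj)

lemma computes_Succ: "y = Suc x \<Longrightarrow> computes Succ [x] y"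
  by (simp add: computes.succ)

lemma computes_Comp1:
  "computes g xs a \<Longrightarrow> computes f [a] z \<Longrightarrow> computes (Comp f [g]) xs z"
  by (rule computes.comp [where ys = "[a]"]) auto

lemma computes_Comp2:
  "computes g xs a \<Longrightarrow> computes h xs b \<Longrightarrow> computes f [a, b] z \<Longrightarrow> computes (Comp f [g, h]) xs z"
  by (rule computes.comp [where ys = "[a, b]"]) auto

lemma computes_PrimRec:
  assumes "computes f xs (r 0)" "\<And>n. computes g (n # r n # xs) (r (Suc n))"
  shows "computes (PrimRec f g) (n # xs) (r n)"
proof (induction n)
  case (Suc n)
  then show ?case using assms(2) by (rule computes.primrec_Suc)
qed (rule computes.primrec_0 [OF assms(1)])

section \<open>Primitive recursive arithmetic and the inverse of the pairing function\<close>

definition "rAdd = PrimRec (Proj 0) (Comp Succ [Proj 1])"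
definition "rTri = PrimRec Zero (Comp rAdd [Proj 1, Comp Succ [Proj 0]])"
definition "rPair = Comp rAdd [Comp rTri [rAdd], Proj 0]"
definition "rPred = PrimRec Zero (Proj 0)"
definition "rSub = PrimRec (Proj 0) (Comp rPred [Proj 1])"
definition "rRoot = PrimRec Zero (Comp rAdd [Proj 1, Comp rSub
  [Comp rSub [Comp Succ [Proj 0], Comp rTri [Comp Succ [Proj 1]]], Comp Succ [Zero]]])"
definition "rFst = Comp rSub [Comp rTri [rRoot], Proj 0]"
definition "rSnd = Comp rSub [rFst, rRoot]"

lemmas recf_step = computes_Proj computes_Succ computes_Comp1 computes_Comp2 computes.zero

lemma computes_rAdd: "z = n + x \<Longrightarrow> computes rAdd [n, x] z"
  unfolding rAdd_def by (simp, rule computes_PrimRec) (auto intro!: recf_step)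

lemma computes_rTri: "z = triangle n \<Longrightarrow> computes rTri [n] z"
  unfolding rTri_def by (simp, rule computes_PrimRec) (auto intro!: recf_step computes_rAdd)

lemma computes_rPair: "z = prod_encode (m, n) \<Longrightarrow> computes rPair [m, n] z"
  unfolding rPair_def
  by (auto simp: prod_encode_def intro!: recf_step computes_rAdd computes_rTri)

lemma computes_rPred: "z = n - 1 \<Longrightarrow> computes rPred [n] z"
  unfolding rPred_def by (simp, rule computes_PrimRec) (auto intro!: recf_step)

text \<open>The arguments of \<open>rSub\<close> are swapped: the recursion is on the subtrahend.\<close>

lemma computes_rSub: "z = x - n \<Longrightarrow> computes rSub [n, x] z"
  unfolding rSub_def
  by (simp, rule computes_PrimRec) (auto intro!: recf_step computes_rPred)

text \<open>The triangular root, the largest k with \<open>triangle k <= n\<close>. As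
  \<open>prod_encode (a, b) = triangle (a + b) + a\<close>, it recovers a + b from the code of a
  pair, and both components follow. The truncated subtraction \<open>1 - ...\<close> is a test: it
  is 1 exactly if \<open>Suc n\<close> has reached the next triangular number.\<close>

fun troot :: "nat \<Rightarrow> nat" where
  "troot 0 = 0"
| "troot (Suc n) = troot n + (1 - (triangle (Suc (troot n)) - Suc n))"

lemma computes_rRoot: "z = troot n \<Longrightarrow> computes rRoot [n] z"
  unfolding rRoot_def
  by (simp, rule computes_PrimRec)
    (auto intro!: recf_step computes_rAdd computes_rSub computes_rTri)

lemma triangle_mono: "m \<le> n \<Longrightarrow> triangle m \<le> triangle n"
  by (induction n) (auto simp: le_Suc_eq)

lemma troot_bounds: "triangle (troot n) \<le> n \<and> n < triangle (Suc (troot n))"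
proof (induction n)
  case (Suc n)
  then show ?case
  proof (cases "triangle (Suc (troot n)) \<le> Suc n")
    case True
    then have "troot (Suc n) = Suc (troot n)" by simp
    then show ?thesis using True Suc by (simp del: troot.simps)
  next
    case False
    then have "troot (Suc n) = troot n" by simp
    then show ?thesis using False Suc by (simp del: troot.simps)
  qed
qed auto

lemma troot_prod_encode: "troot (prod_encode (a, b)) = a + b"
proof (rule ccontr)
  define n where "n = prod_encode (a, b)"
  have n: "triangle (a + b) \<le> n" "n < triangle (Suc (a + b))"
    by (auto simp: n_def prod_encode_def)
  assume "troot (prod_encode (a, b)) \<noteq> a + b"
  then consider "Suc (troot n) \<le> a + b" | "Suc (a + b) \<le> troot n"
    unfolding n_def by linarith
  then show False
  proof cases
    case 1
    then show False using triangle_mono [OF 1] n troot_bounds [of n] by linarith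
  next
    case 2
    then show False using triangle_mono [OF 2] n troot_bounds [of n] by linarith
  qed
qed

lemma computes_rFst: "computes rFst [prod_encode (a, b)] a"
  unfolding rFst_def
  by (auto intro!: recf_step computes_rSub computes_rTri computes_rRoot)
    (use troot_prod_encode [of a b] in \<open>simp add: prod_encode_def\<close>)

lemma computes_rSnd: "computes rSnd [prod_encode (a, b)] b"
  unfolding rSnd_def
  by (rule recf_step computes_rFst computes_rRoot computes_rSub refl)+
    (simp add: troot_prod_encode)

text \<open>Codes are bijections rather than injections, so that every number decodes to a value:
  unbounded search over numbers is then search over the whole type, and \<open>dec\<close> is
  computable on all numbers.\<close>

class coded =
  fixes enc :: "'a \<Rightarrow> nat"
  assumes bij_enc: "bij enc"
begin

definition dec :: "nat \<Rightarrow> 'a" where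
  "dec = inv enc"

lemma enc_inject [simp]: "enc x = enc y \<longleftrightarrow> x = y"
  using bij_enc by (auto simp: bij_def dest: injD)

lemma enc_dec [simp]: "enc (dec n) = n"
  using bij_enc by (simp add: dec_def bij_is_surj surj_f_inv_f)

lemma dec_enc [simp]: "dec (enc x) = x"
  using enc_dec [of "enc x"] by (simp only: enc_inject)

end

instantiation nat :: coded
begin
definition enc_nat :: "nat \<Rightarrow> nat" where [simp]: "enc_nat n = n"
instance by standard (simp add: bij_def inj_def surj_def)
end

instantiation prod :: (coded, coded) coded
begin
definition enc_prod :: "'a \<times> 'b \<Rightarrow> nat" where
  "enc_prod p = prod_encode (enc (fst p), enc (snd p))"
instance
proof
  show "bij (enc :: 'a \<times> 'b \<Rightarrow> nat)"
    by (rule o_bij [where g = "map_prod dec dec \<circ> prod_decode"])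
      (simp_all add: fun_eq_iff enc_prod_def)
qed
end

instantiation list :: (coded) coded
begin
definition enc_list :: "'a list \<Rightarrow> nat" where
  "enc_list xs = list_encode (map enc xs)"
instance
proof
  show "bij (enc :: 'a list \<Rightarrow> nat)"
    by (rule o_bij [where g = "map dec \<circ> list_decode"])
      (simp_all add: fun_eq_iff enc_list_def comp_def)
qed
end

lemma enc_Pair [simp]: "enc (a, b) = prod_encode (enc a, enc b)"
  by (simp add: enc_prod_def)

lemma enc_Nil [simp]: "enc [] = 0"
  and enc_Cons [simp]: "enc (x # xs) = Suc (prod_encode (enc x, enc xs))"
  by (simp_all add: enc_list_def)

section \<open>Computable functions and decidable predicates on codes\<close>

definition computable :: "('a::coded \<Rightarrow> 'b::coded) \<Rightarrow> bool" where
  "computable f \<longleftrightarrow> (\<exists>r. \<forall>x. computes r [enc x] (enc (f x)))"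

text \<open>The rules follow the shape of the goal, so that \<open>intro\<close> shows computability
  of a composite expression. A function under a binder is treated as a function of the tuple of the
  ambient argument and its bound variables, hence the projections in the premises.\<close>

named_theorems computable_intros

lemma total_recursive_if_computable: "computable g \<Longrightarrow> total_recursive g"
  by (simp add: computable_def total_recursive_def)

text \<open>The result types of \<open>f\<close> and \<open>h\<close> may differ. Constructors and
  selectors are computable because values of different types share a code, for instance an atom and
  the pair of its symbol and its argument list.\<close>

lemma computable_cong_enc:
  assumes "\<And>x. enc (f x) = enc (h x)" "computable h"
  shows "computable f"
  using assms by (simp add: computable_def)

lemma computable_enc_eq:
  assumes "\<And>x. enc (f x) = h (enc x)" "computable h"
  shows "computable f"
  using assms unfolding computable_def by (metis enc_nat_def)

lemma computable_id [computable_intros]: "computable (\<lambda>x. x)"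
  unfolding computable_def by (rule exI [of _ "Proj 0"]) (auto intro!: recf_step)

lemma computable_const [computable_intros]: "computable (\<lambda>x. c)"
proof -
  have "\<exists>r. \<forall>xs. computes r xs n" for n
  proof (induction n)
    case 0
    show ?case using computes.zero by blast
  next
    case (Suc n)
    then obtain r where "\<forall>xs. computes r xs n" by blast
    then show ?case by (intro exI [of _ "Comp Succ [r]"]) (auto intro: recf_step)
  qed
  then show ?thesis by (fastforce simp: computable_def)
qed

lemma computable_comp:
  assumes "computable f" "computable g"
  shows "computable (\<lambda>x. f (g x))"
proof -
  obtain rf rg where "\<forall>x. computes rf [enc x] (enc (f x))" "\<forall>x. computes rg [enc x] (enc (g x))"
    using assms by (auto simp: computable_def)
  then show ?thesis unfolding computable_def
    by (intro exI [of _ "Comp rf [rg]"]) (auto intro: recf_step)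
qed

lemma computable_Pair [computable_intros]:
  assumes "computable f" "computable g"
  shows "computable (\<lambda>x. (f x, g x))"
proof -
  obtain rf rg where "\<forall>x. computes rf [enc x] (enc (f x))" "\<forall>x. computes rg [enc x] (enc (g x))"
    using assms by (auto simp: computable_def)
  then show ?thesis unfolding computable_def
    by (intro exI [of _ "Comp rPair [rf, rg]"]) (auto intro: recf_step computes_rPair)
qed

lemma computable_fst [computable_intros]:
  assumes "computable f"
  shows "computable (\<lambda>x. fst (f x))"
  by (rule computable_comp [OF _ assms])
    (auto simp: computable_def intro!: exI [of _ rFst] computes_rFst)

lemma computable_snd [computable_intros]:
  assumes "computable f"
  shows "computable (\<lambda>x. snd (f x))"
  by (rule computable_comp [OF _ assms])
    (auto simp: computable_def intro!: exI [of _ rSnd] computes_rSnd)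

lemma computable_enc [computable_intros]: "computable f \<Longrightarrow> computable (\<lambda>x. enc (f x))"
  by (simp add: computable_def)

lemma computable_dec [computable_intros]: "computable f \<Longrightarrow> computable (\<lambda>x. dec (f x))"
  by (simp add: computable_def)

lemma computable_Suc [computable_intros]:
  assumes "computable f"
  shows "computable (\<lambda>x. Suc (f x))"
  by (rule computable_comp [OF _ assms])
    (auto simp: computable_def intro!: exI [of _ Succ] recf_step)

lemma computable_rec_nat [computable_intros]:
  assumes "computable a" "computable (\<lambda>p. g (fst p) (fst (snd p)) (snd (snd p)))" "computable k"
  shows "computable (\<lambda>x. rec_nat (a x) (g x) (k x))"
proof -
  obtain ra where ra: "\<And>x. computes ra [enc x] (enc (a x))"
    using assms(1) by (auto simp: computable_def)
  obtain rg where "\<And>p. computes rg [enc p] (enc (g (fst p) (fst (snd p)) (snd (snd p))))"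
    using assms(2) unfolding computable_def by blast
  from this [of "(x, n, y)" for x n y]
  have rg: "computes rg [prod_encode (enc x, prod_encode (n, enc y))] (enc (g x n y))" for x n y
    by simp
  obtain rk where rk: "\<And>x. computes rk [enc x] (k x)"
    using assms(3) by (auto simp: computable_def)
  \<comment> \<open>\<open>PrimRec\<close> passes the counter, the previous value and the parameter
    in this order, whereas the code for \<open>g\<close> expects the parameter first.\<close>
  define rg' where "rg' = Comp rg [Comp rPair [Proj 2, Comp rPair [Proj 0, Proj 1]]]"
  have "computes (PrimRec ra rg') [n, enc x] (enc (rec_nat (a x) (g x) n))" for n x
    by (rule computes_PrimRec)
      (auto simp: rg'_def intro!: recf_step computes_rPair ra rg)
  then have "computes (Comp (PrimRec ra rg') [rk, Proj 0]) [enc x]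
      (enc (rec_nat (a x) (g x) (k x)))" for x
    by (auto intro!: rk recf_step)
  then show ?thesis unfolding computable_def by blast
qed

definition decidable :: "('a::coded \<Rightarrow> bool) \<Rightarrow> bool" where
  "decidable P \<longleftrightarrow> computable (\<lambda>x. of_bool (P x) :: nat)"

lemma recursively_enumerable_if_decidable:
  fixes Q :: "nat \<times> 'c::coded \<Rightarrow> bool"
  assumes "decidable Q"
  shows "recursively_enumerable {x. \<exists>c. Q (x, c)}"
proof -
  obtain r where r: "\<And>x c. computes r [enc (x, c)] (of_bool (Q (x, c)))"
    using assms by (auto simp: decidable_def computable_def)
  \<comment> \<open>The search variable comes first, as \<open>Mu\<close> demands, and the value is
    0 exactly at the codes of witnesses.\<close>
  define q where "q = Comp rSub [Comp r [Comp rPair [Proj 1, Proj 0]], Comp Succ [Zero]]"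
  have q: "computes q [n, x] (1 - of_bool (Q (x, dec n)))" for n x
    using r [of x "dec n"] unfolding q_def
    by (auto intro!: recf_step computes_rSub computes_rPair)
  have "(\<exists>y. computes (Mu q) [x] y) \<longleftrightarrow> (\<exists>c. Q (x, c))" for x
  proof
    assume "\<exists>y. computes (Mu q) [x] y"
    then obtain n where "computes q [n, x] 0"
      by (auto elim: computes.cases)
    from computes_fun [OF this q] show "\<exists>c. Q (x, c)"
      by (auto simp: of_bool_def split: if_splits)
  next
    assume "\<exists>c. Q (x, c)"
    then have "\<exists>n. Q (x, dec n)" by (metis dec_enc)
    define n where "n = (LEAST n. Q (x, dec n))"
    have "Q (x, dec n)" unfolding n_def using \<open>\<exists>n. Q (x, dec n)\<close> by (rule LeastI_ex)
    moreover have "\<not> Q (x, dec i)" if "i < n" for i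
      using that not_less_Least unfolding n_def by blast
    ultimately have "of_bool (Q (x, dec n)) = (1 :: nat)" "\<forall>i<n. of_bool (Q (x, dec i)) = (0 :: nat)"
      by simp_all
    then have "computes q [n, x] 0" "\<forall>i<n. computes q [i, x] (Suc 0)"
      using q [of n x] q [of _ x] by (simp, metis One_nat_def minus_nat.diff_0)
    then show "\<exists>y. computes (Mu q) [x] y"
      by (intro exI computes.mu) auto
  qed
  then show ?thesis unfolding recursively_enumerable_def
    by (intro exI [of _ "Mu q"]) simp
qed

lemma computable_If [computable_intros]:
  assumes "decidable P" "computable a" "computable b"
  shows "computable (\<lambda>x. if P x then a x else b x)"
proof -
  have "(if P x then a x else b x) = rec_nat (b x) (\<lambda>_ _. a x) (of_bool (P x) :: nat)" for x
    by simp
  moreover have "computable (\<lambda>x. rec_nat (b x) (\<lambda>_ _. a x) (of_bool (P x) :: nat))"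
    by (intro computable_rec_nat assms computable_comp [OF assms(2)] computable_intros)
      (use assms(1) in \<open>simp add: decidable_def\<close>)
  ultimately show ?thesis by simp
qed

lemma computable_case_nat [computable_intros]:
  assumes "computable a" "computable (\<lambda>p. g (fst p) (snd p))" "computable k"
  shows "computable (\<lambda>x. case k x of 0 \<Rightarrow> a x | Suc n \<Rightarrow> g x n)"
proof -
  have "(case k x of 0 \<Rightarrow> a x | Suc n \<Rightarrow> g x n) = rec_nat (a x) (\<lambda>n _. g x n) (k x)" for x
    by (cases "k x") auto
  moreover have "computable (\<lambda>x. rec_nat (a x) (\<lambda>n _. g x n) (k x))"
    by (intro computable_rec_nat assms)
      (use computable_comp [OF assms(2), of "\<lambda>p. (fst p, fst (snd p))"] in
        \<open>simp add: computable_intros\<close>)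
  ultimately show ?thesis by simp
qed

lemma computable_add [computable_intros]:
  fixes f g :: "'a::coded \<Rightarrow> nat"
  assumes "computable f" "computable g"
  shows "computable (\<lambda>x. f x + g x)"
proof -
  have "m + n = rec_nat n (\<lambda>_ r. Suc r) m" for m n :: nat
    by (induction m) auto
  then show ?thesis by (simp, intro computable_intros assms)
qed

lemma computable2:
  assumes "computable (\<lambda>p. g (fst p) (snd p))" "computable a" "computable b"
  shows "computable (\<lambda>x. g (a x) (b x))"
  using computable_comp [OF assms(1) computable_Pair [OF assms(2,3)]] by simp

lemma computable3:
  assumes "computable (\<lambda>p. g (fst p) (fst (snd p)) (snd (snd p)))"
    "computable a" "computable b" "computable c"
  shows "computable (\<lambda>x. g (a x) (b x) (c x))"
  using computable_comp [OF assms(1) computable_Pair [OF assms(2) computable_Pair [OF assms(3,4)]]]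
  by simp

lemma decidable2:
  assumes "decidable (\<lambda>p. P (fst p) (snd p))" "computable a" "computable b"
  shows "decidable (\<lambda>x. P (a x) (b x))"
  using assms unfolding decidable_def by (rule computable2)

lemma computable_diff [computable_intros]:
  fixes f g :: "'a::coded \<Rightarrow> nat"
  assumes "computable f" "computable g"
  shows "computable (\<lambda>x. f x - g x)"
proof -
  have "m - n = rec_nat m (\<lambda>_ r. case r of 0 \<Rightarrow> 0 | Suc k \<Rightarrow> k) n" for m n :: nat
    by (induction n) (auto split: nat.split)
  then show ?thesis by (simp, intro computable_intros assms)
qed

lemma computable_mult [computable_intros]:
  fixes f g :: "'a::coded \<Rightarrow> nat"
  assumes "computable f" "computable g"
  shows "computable (\<lambda>x. f x * g x)"
proof -
  have "m * n = rec_nat 0 (\<lambda>_ r. n + r) m" for m n :: nat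
    by (induction m) auto
  then show ?thesis by (simp, intro computable_intros assms computable_comp [OF assms(2)])
qed

lemma computable_power [computable_intros]:
  fixes f g :: "'a::coded \<Rightarrow> nat"
  assumes "computable f" "computable g"
  shows "computable (\<lambda>x. f x ^ g x)"
proof -
  have "m ^ n = rec_nat 1 (\<lambda>_ r. m * r) n" for m n :: nat
    by (induction n) auto
  then show ?thesis by (simp, intro computable_intros assms computable_comp [OF assms(1)])
qed

lemma computable_mod2 [computable_intros]:
  assumes "computable f"
  shows "computable (\<lambda>x. f x mod 2 :: nat)"
proof -
  have "n mod 2 = rec_nat 0 (\<lambda>_ r. 1 - r) n" for n :: nat
    by (induction n) (auto simp: mod_Suc)
  then show ?thesis by (simp, intro computable_intros assms)
qed

lemma computable_div2 [computable_intros]: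
  assumes "computable f"
  shows "computable (\<lambda>x. f x div 2 :: nat)"
proof -
  have "n div 2 = rec_nat 0 (\<lambda>k r. r + k mod 2) n" for n :: nat
    by (induction n) (auto, presburger+)
  then show ?thesis by (simp, intro computable_intros assms)
qed

lemma decidable_eq [computable_intros]:
  assumes "computable f" "computable g"
  shows "decidable (\<lambda>x. f x = g x)"
proof -
  have "of_bool (f x = g x) = 1 - ((enc (f x) - enc (g x)) + (enc (g x) - enc (f x)))" for x
  proof (cases "f x = g x")
    case False
    then have "enc (f x) \<noteq> enc (g x)" by simp
    then show ?thesis using False by (simp only: of_bool_eq)
  qed simp
  then show ?thesis unfolding decidable_def by (simp only:) (intro computable_intros assms)
qed

lemma decidable_not [computable_intros]:
  assumes "decidable P"
  shows "decidable (\<lambda>x. \<not> P x)"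
proof -
  have "computable (\<lambda>x. 1 - of_bool (P x) :: nat)"
    using assms unfolding decidable_def by (intro computable_intros)
  then show ?thesis unfolding decidable_def
    by (rule computable_cong_enc [rotated]) simp
qed

lemma decidable_conj [computable_intros]:
  assumes "decidable P" "decidable Q"
  shows "decidable (\<lambda>x. P x \<and> Q x)"
proof -
  have "computable (\<lambda>x. of_bool (P x) * of_bool (Q x) :: nat)"
    using assms unfolding decidable_def by (intro computable_intros)
  then show ?thesis unfolding decidable_def
    by (rule computable_cong_enc [rotated]) simp
qed

lemma decidable_imp [computable_intros]:
  assumes "decidable P" "decidable Q"
  shows "decidable (\<lambda>x. P x \<longrightarrow> Q x)"
proof -
  have "decidable (\<lambda>x. \<not> (P x \<and> \<not> Q x))"
    by (intro computable_intros assms)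
  then show ?thesis by simp
qed

section \<open>Computable operations on lists\<close>

lemma computable_Cons [computable_intros]:
  assumes "computable f" "computable g"
  shows "computable (\<lambda>x. f x # g x)"
proof -
  have "computable (\<lambda>x. Suc (enc (f x, g x)))"
    by (intro computable_intros assms)
  then show ?thesis by (rule computable_cong_enc [rotated]) simp
qed

lemma computable_case_list [computable_intros]:
  assumes "computable a" "computable (\<lambda>p. b (fst p) (fst (snd p)) (snd (snd p)))" "computable l"
  shows "computable (\<lambda>x. case l x of [] \<Rightarrow> a x | y # ys \<Rightarrow> b x y ys)"
proof -
  \<comment> \<open>Splitting a list works on codes: that of a nonempty list is the successor of the
    code of its head and tail. The first component of \<open>p\<close> is a default pair for the
    empty list, which has no head.\<close>
  define u where "u p = (case snd p of [] \<Rightarrow> fst p | y # ys \<Rightarrow> (y, ys))"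
    for p :: "('c \<times> 'c list) \<times> 'c list"
  have u: "computable u"
  proof (rule computable_enc_eq)
    show "enc (u p) = (\<lambda>n. if snd (dec n :: nat \<times> nat) = 0 then fst (dec n :: nat \<times> nat)
        else snd (dec n :: nat \<times> nat) - 1) (enc p)" for p
    proof -
      have "enc p = enc (enc (fst p), enc (snd p))"
        by (cases p) simp
      then have "(dec (enc p) :: nat \<times> nat) = (enc (fst p), enc (snd p))"
        by (simp only: dec_enc)
      then show ?thesis by (cases "snd p") (auto simp: u_def)
    qed
  qed (intro computable_intros)
  have "(case l x of [] \<Rightarrow> a x | y # ys \<Rightarrow> b x y ys) =
      (if l x = [] then a x else b x (fst (u (undefined, l x))) (snd (u (undefined, l x))))" for x
    by (cases "l x") (auto simp: u_def)
  then show ?thesis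
    by (simp only:)
      (intro computable_intros assms computable3 [OF assms(2)] computable_comp [OF u])
qed

lemma length_le_enc: "length xs \<le> enc xs"
proof (induction xs)
  case (Cons x xs)
  then show ?case using le_prod_encode_2 [of "enc xs" "enc x"] by simp
qed simp

text \<open>A left fold iterates a step on the accumulator and the remaining list. The step does
  nothing once the list is used up, so any upper bound on the length serves as the number of
  iterations, and the code of the list is one that is at hand.\<close>

lemma computable_foldl [computable_intros]:
  assumes "computable (\<lambda>p. f (fst p) (fst (snd p)) (snd (snd p)))" "computable a" "computable l"
  shows "computable (\<lambda>x. foldl (f x) (a x) (l x))"
proof -
  define step where "step x s = (case snd s of [] \<Rightarrow> s | y # ys \<Rightarrow> (f x (fst s) y, ys))" for x s
  have iter: "fst (rec_nat (c, ys) (\<lambda>_. step x) k) = foldl (f x) c ys" if "length ys \<le> k"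
    for x c ys k
  proof -
    have "rec_nat (c, ys) (\<lambda>_. step x) k = (foldl (f x) c (take k ys), drop k ys)" for k
    proof (induction k)
      case (Suc k)
      show ?case
      proof (cases "k < length ys")
        case True
        then show ?thesis using Suc
          by (simp add: step_def take_Suc_conv_app_nth flip: Cons_nth_drop_Suc)
      next
        case False
        then show ?thesis using Suc by (simp add: step_def)
      qed
    qed simp
    then show ?thesis using that by simp
  qed
  have "computable (\<lambda>x. fst (rec_nat (a x, l x) (\<lambda>_. step x) (enc (l x))))"
    unfolding step_def by (intro computable_intros assms computable3 [OF assms(1)])
  then show ?thesis by (simp add: iter length_le_enc)
qed

lemma computable_rev [computable_intros]:
  assumes "computable l"
  shows "computable (\<lambda>x. rev (l x))"
proof -
  have "computable (\<lambda>x. foldl (\<lambda>ys y. y # ys) [] (l x))"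
    by (intro computable_intros assms)
  moreover have "foldl (\<lambda>ys y. y # ys) zs xs = rev xs @ zs" for xs zs :: "'b list"
    by (induction xs arbitrary: zs) auto
  ultimately show ?thesis by simp
qed

lemma computable_append [computable_intros]:
  assumes "computable l" "computable m"
  shows "computable (\<lambda>x. l x @ m x)"
proof -
  have "computable (\<lambda>x. foldl (\<lambda>ys y. y # ys) (m x) (rev (l x)))"
    by (intro computable_intros assms)
  moreover have "foldl (\<lambda>ys y. y # ys) zs xs = rev xs @ zs" for xs zs :: "'b list"
    by (induction xs arbitrary: zs) auto
  ultimately show ?thesis by simp
qed

lemma computable_map [computable_intros]:
  assumes "computable (\<lambda>p. f (fst p) (snd p))" "computable l"
  shows "computable (\<lambda>x. map (f x) (l x))"
proof -
  have "computable (\<lambda>x. foldl (\<lambda>ys y. ys @ [f x y]) [] (l x))"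
    by (intro computable_intros assms computable2 [OF assms(1)])
  moreover have "foldl (\<lambda>ys y. ys @ [g y]) zs xs = zs @ map g xs" for g and xs :: "'b list" and zs :: "'c list"
    by (induction xs arbitrary: zs) auto
  ultimately show ?thesis by simp
qed

lemma computable_concat [computable_intros]:
  assumes "computable l"
  shows "computable (\<lambda>x. concat (l x))"
proof -
  have "computable (\<lambda>x. foldl (@) [] (l x))"
    by (intro computable_intros assms)
  moreover have "foldl (@) zs xs = zs @ concat xs" for xs and zs :: "'b list"
    by (induction xs arbitrary: zs) auto
  ultimately show ?thesis by simp
qed

lemma computable_filter [computable_intros]:
  assumes "decidable (\<lambda>p. P (fst p) (snd p))" "computable l"
  shows "computable (\<lambda>x. filter (P x) (l x))"
proof -
  have "computable (\<lambda>x. concat (map (\<lambda>y. if P x y then [y] else []) (l x)))"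
    by (intro computable_intros assms decidable2 [OF assms(1)])
  moreover have "concat (map (\<lambda>y. if Q y then [y] else []) xs) = filter Q xs"
    for Q and xs :: "'b list"
    by (induction xs) auto
  ultimately show ?thesis by simp
qed

lemma computable_sum_list [computable_intros]:
  fixes l :: "'a::coded \<Rightarrow> nat list"
  assumes "computable l"
  shows "computable (\<lambda>x. sum_list (l x))"
proof -
  have "computable (\<lambda>x. foldl (+) 0 (l x))"
    by (intro computable_intros assms)
  moreover have "foldl (+) n xs = n + sum_list xs" for xs and n :: nat
    by (induction xs arbitrary: n) auto
  ultimately show ?thesis by simp
qed

lemma computable_length [computable_intros]:
  assumes "computable l"
  shows "computable (\<lambda>x. length (l x))"
proof -
  have "computable (\<lambda>x. sum_list (map (\<lambda>_. 1) (l x)) :: nat)"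
    by (intro computable_intros assms)
  then show ?thesis by (simp add: sum_list_triv)
qed

lemma computable_upt [computable_intros]:
  assumes "computable f"
  shows "computable (\<lambda>x. [0..<f x])"
proof -
  have "[0..<n] = rec_nat [] (\<lambda>k l. l @ [k]) n" for n
    by (induction n) auto
  then show ?thesis by (simp, intro computable_intros assms)
qed

lemma computable_drop [computable_intros]:
  assumes "computable k" "computable l"
  shows "computable (\<lambda>x. drop (k x) (l x))"
proof -
  have "drop n xs = rec_nat xs (\<lambda>_ l. case l of [] \<Rightarrow> [] | y # ys \<Rightarrow> ys) n" for n and xs :: "'b list"
  proof (induction n)
    case (Suc n)
    then show ?case by (simp flip: tl_drop drop_Suc split: list.split add: drop_Suc tl_drop)
  qed simp
  then show ?thesis by (simp, intro computable_intros assms)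
qed

lemma computable_n_lists [computable_intros]:
  assumes "computable k" "computable l"
  shows "computable (\<lambda>x. List.n_lists (k x) (l x))"
proof -
  have "List.n_lists n xs =
      rec_nat [[]] (\<lambda>_ r. concat (map (\<lambda>ys. map (\<lambda>y. y # ys) xs) r)) n" for n and xs :: "'b list"
    by (induction n) auto
  then show ?thesis by (simp, intro computable_intros assms computable_comp [OF assms(2)])
qed

lemma decidable_Ball [computable_intros]:
  assumes "decidable (\<lambda>p. P (fst p) (snd p))" "computable l"
  shows "decidable (\<lambda>x. \<forall>y\<in>set (l x). P x y)"
proof -
  have "decidable (\<lambda>x. filter (\<lambda>y. \<not> P x y) (l x) = [])"
    by (intro computable_intros assms decidable2 [OF assms(1)])
  then show ?thesis by (simp add: filter_empty_conv)
qed

lemma decidable_Bex [computable_intros]: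
  assumes "decidable (\<lambda>p. P (fst p) (snd p))" "computable l"
  shows "decidable (\<lambda>x. \<exists>y\<in>set (l x). P x y)"
proof -
  have "decidable (\<lambda>x. \<not> (\<forall>y\<in>set (l x). \<not> P x y))"
    by (intro computable_intros assms decidable2 [OF assms(1)])
  then show ?thesis by simp
qed

lemma decidable_mem [computable_intros]:
  assumes "computable f" "computable l"
  shows "decidable (\<lambda>x. f x \<in> set (l x))"
proof -
  have "decidable (\<lambda>x. \<exists>y\<in>set (l x). f x = y)"
    by (intro computable_intros assms computable_comp [OF assms(1)])
  then show ?thesis by simp
qed

text \<open>The members of the finite set coded by n, as positions of binary digits 1. Searching
  below n suffices because a member i satisfies 2^i <= n. The recursion is division by 2^i in a form
  to which the computability rules apply.\<close>

definition bits :: "nat \<Rightarrow> nat list" where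
  "bits n = filter (\<lambda>i. (rec_nat n (\<lambda>_ m. m div 2) i) mod 2 = 1) [0..<n]"

lemma set_bits: "set (bits n) = set_decode n"
proof -
  have *: "rec_nat n (\<lambda>_ m. m div 2) i = n div 2 ^ i" for i
    by (induction i) (simp_all add: div_mult2_eq power_commutes flip: div_mult2_eq)
  have "i < n" if "i \<in> set_decode n" for i
  proof -
    have "2 ^ i \<le> n" using that by (cases "n < 2 ^ i") (auto simp: set_decode_def)
    then show ?thesis using less_exp [of i] by linarith
  qed
  then show ?thesis
    by (auto simp: bits_def * set_decode_def odd_iff_mod_2_eq_one)
qed

lemma computable_bits [computable_intros]:
  assumes "computable f"
  shows "computable (\<lambda>x. bits (f x))"
  by (rule computable_comp [OF _ assms]) (unfold bits_def, intro computable_intros)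

section \<open>Homomorphisms and chase steps\<close>

definition chom :: "(val \<Rightarrow> val) \<Rightarrow> fact set \<Rightarrow> fact set \<Rightarrow> bool" where
  "chom g I J \<longleftrightarrow> (\<forall>c. g (Const c) = Const c) \<and> map_atom g ` I \<subseteq> J"

definition maps_to :: "fact set \<Rightarrow> fact set \<Rightarrow> bool" where
  "maps_to I J \<longleftrightarrow> (\<exists>g. chom g I J)"

lemma vals_image: "vals (map_atom g ` I) = g ` vals I"
  by (auto simp: vals_def atom.set_map)

lemma finite_vals: "finite I \<Longrightarrow> finite (vals I)"
proof -
  have "finite (set_atom a)" for a :: "'a atom"
    by (cases a) simp
  then show "finite I \<Longrightarrow> finite (vals I)" by (simp add: vals_def)
qed

lemma homomorphism_if_chom: "chom g I J \<Longrightarrow> homomorphism g I J"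
  by (simp add: chom_def homomorphism_def)

text \<open>Heads of tgds may contain constants that do not occur in the instance, so homomorphisms are
  normalised to fix all constants.\<close>

lemma chom_if_homomorphism:
  assumes "homomorphism g I J"
  shows "chom (case_val Const (\<lambda>n. g (Null n))) I J"
proof -
  have "map_atom (case_val Const (\<lambda>n. g (Null n))) a = map_atom g a" if "a \<in> I" for a
  proof (rule atom.map_cong0)
    fix v assume "v \<in> set_atom a"
    then have "v \<in> vals I" using that by (auto simp: vals_def)
    then show "case_val Const (\<lambda>n. g (Null n)) v = g v"
      using assms by (cases v) (auto simp: homomorphism_def)
  qed
  then show ?thesis
    using assms by (auto simp: chom_def homomorphism_def)
qed

lemma chom_comp: "chom g I J \<Longrightarrow> chom h J K \<Longrightarrow> chom (h \<circ> g) I K"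
  by (simp add: chom_def image_subset_iff flip: atom.map_comp)

lemma chom_mono: "chom g I J \<Longrightarrow> I' \<subseteq> I \<Longrightarrow> J \<subseteq> J' \<Longrightarrow> chom g I' J'"
  unfolding chom_def by blast

lemma chom_id: "I \<subseteq> J \<Longrightarrow> chom id I J"
  by (auto simp: chom_def atom.map_id)

lemma maps_to_trans: "maps_to I J \<Longrightarrow> maps_to J K \<Longrightarrow> maps_to I K"
  unfolding maps_to_def by (blast intro: chom_comp)

lemma maps_to_subset: "I \<subseteq> J \<Longrightarrow> maps_to I J"
  using chom_id by (auto simp: maps_to_def)

section \<open>Satisfaction of heads and extension of homomorphisms\<close>

lemma facts_of_cong:
  assumes "\<And>x. x \<in> vars as \<Longrightarrow> h x = h' x"
  shows "facts_of h as = facts_of h' as"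
  unfolding facts_of_def
proof (rule image_cong)
  fix a assume a: "a \<in> set as"
  show "map_atom (val_of h) a = map_atom (val_of h') a"
  proof (rule atom.map_cong0)
    fix t assume "t \<in> set_atom a"
    then have "x \<in> vars as" if "t = Var x" for x
      using a that unfolding vars_def by blast
    then show "val_of h t = val_of h' t"
      using assms by (cases t) simp_all
  qed
qed simp

lemma facts_of_image:
  assumes "\<And>c. g (Const c) = Const c"
    and "\<And>x. x \<in> vars as \<Longrightarrow> the (h' x) = g (the (h x))"
  shows "facts_of h' as = map_atom g ` facts_of h as"
  unfolding facts_of_def image_image
proof (rule image_cong)
  fix a assume a: "a \<in> set as"
  show "map_atom (val_of h') a = map_atom g (map_atom (val_of h) a)"
    unfolding atom.map_comp
  proof (rule atom.map_cong0)
    fix t assume "t \<in> set_atom a"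
    then have "x \<in> vars as" if "t = Var x" for x
      using a that unfolding vars_def by blast
    then show "val_of h' t = (g \<circ> val_of h) t"
      using assms by (cases t) simp_all
  qed
qed simp

lemma vars_in_vals:
  assumes "facts_of h as \<subseteq> I" "x \<in> vars as"
  shows "the (h x) \<in> vals I"
proof -
  obtain a where a: "a \<in> set as" "Var x \<in> set_atom a"
    using assms(2) by (auto simp: vars_def)
  have "val_of h (Var x) \<in> set_atom (map_atom (val_of h) a)"
    using a(2) unfolding atom.set_map by (rule imageI)
  moreover have "map_atom (val_of h) a \<in> I"
    using a(1) assms(1) unfolding facts_of_def by blast
  ultimately show ?thesis unfolding vals_def by auto
qed

lemma finite_vars: "finite (vars as)"
proof -
  have "finite (set_atom a)" for a :: "'a atom"
    by (cases a) simp
  then have "finite (\<Union>a\<in>set as. set_atom a)" by simp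
  moreover have "vars as = Var -` (\<Union>a\<in>set as. set_atom a)"
    by (auto simp: vars_def)
  ultimately show ?thesis by (simp add: finite_vimageI inj_def)
qed

text \<open>Separated from the notion of an active trigger so that a head can be evaluated in an
  instance other than the one where the body was matched.\<close>

definition satisfied :: "tgd \<Rightarrow> (nat \<rightharpoonup> val) \<Rightarrow> fact set \<Rightarrow> bool" where
  "satisfied \<xi> h J \<longleftrightarrow>
     (\<exists>h'. h \<subseteq>\<^sub>m h' \<and> dom h' = uvars \<xi> \<union> evars \<xi> \<and> facts_of h' (head \<xi>) \<subseteq> J)"

lemma active_triggers_eq:
  "active_triggers \<Sigma> I = {(\<xi>, h) \<in> triggers \<Sigma> I. \<not> satisfied \<xi> h I}"
  by (simp add: active_triggers_def satisfied_def)

lemma satisfied_mono: "satisfied \<xi> h I \<Longrightarrow> I \<subseteq> J \<Longrightarrow> satisfied \<xi> h J"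
  unfolding satisfied_def by (meson order_trans)

lemma vars_head: "vars (head \<xi>) \<subseteq> uvars \<xi> \<union> evars \<xi>"
  by (auto simp: uvars_def evars_def)

lemma not_uvars_if_evars: "x \<in> evars \<xi> \<Longrightarrow> x \<notin> uvars \<xi>"
  by (auto simp: uvars_def evars_def)

lemma satisfied_chom:
  assumes "satisfied \<xi> h I" "chom g I J"
  shows "satisfied \<xi> (map_option g \<circ> h) J"
proof -
  obtain h' where h': "h \<subseteq>\<^sub>m h'" "dom h' = uvars \<xi> \<union> evars \<xi>" "facts_of h' (head \<xi>) \<subseteq> I"
    using assms(1) by (auto simp: satisfied_def)
  have "facts_of (map_option g \<circ> h') (head \<xi>) = map_atom g ` facts_of h' (head \<xi>)"
  proof (rule facts_of_image)
    fix x assume "x \<in> vars (head \<xi>)"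
    then have "x \<in> dom h'" using h'(2) vars_head by blast
    then show "the ((map_option g \<circ> h') x) = g (the (h' x))" by auto
  qed (use assms(2) in \<open>simp add: chom_def\<close>)
  then have "facts_of (map_option g \<circ> h') (head \<xi>) \<subseteq> J"
    using h'(3) assms(2) unfolding chom_def by (metis image_mono order_trans)
  moreover have "map_option g \<circ> h \<subseteq>\<^sub>m map_option g \<circ> h'"
    using h'(1) by (auto simp: map_le_def dom_def)
  ultimately show ?thesis using h'(2) unfolding satisfied_def
    by (intro exI [of _ "map_option g \<circ> h'"]) (auto simp: dom_def)
qed

lemma triggers_chom:
  assumes "(\<xi>, h) \<in> triggers \<Sigma> I" "chom g I J"
  shows "(\<xi>, map_option g \<circ> h) \<in> triggers \<Sigma> J"
proof -
  have "facts_of (map_option g \<circ> h) (body \<xi>) = map_atom g ` facts_of h (body \<xi>)"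
  proof (rule facts_of_image)
    fix x assume "x \<in> vars (body \<xi>)"
    then have "x \<in> dom h" using assms(1) by (simp add: triggers_def uvars_def)
    then show "the ((map_option g \<circ> h) x) = g (the (h x))" by auto
  qed (use assms(2) in \<open>simp add: chom_def\<close>)
  moreover have "facts_of h (body \<xi>) \<subseteq> I" "map_atom g ` I \<subseteq> J"
    using assms by (simp_all add: chom_def triggers_def)
  ultimately have "facts_of (map_option g \<circ> h) (body \<xi>) \<subseteq> J"
    by (metis image_mono order_trans)
  then show ?thesis using assms(1) by (auto simp: triggers_def dom_def)
qed

text \<open>The fresh nulls are distinct for distinct triggers and variables and do not occur in
  \<open>I\<close>, so \<open>g\<close> can be extended to each of them independently: the null for
  z in t goes to the witness for z in a match of the head of t in \<open>K\<close>. As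
  \<open>T\<close> is any set of triggers, this covers a parallel step as well as the firing of a
  single trigger, active or not.\<close>

lemma chom_extend_fire:
  assumes g: "chom g I K" and T: "T \<subseteq> triggers \<Sigma> I" and fresh: "fresh_nulls I T \<nu>"
    and sat: "\<And>\<xi> h. (\<xi>, h) \<in> T \<Longrightarrow> satisfied \<xi> (map_option g \<circ> h) K"
  shows "maps_to (I \<union> (\<Union>t\<in>T. fire \<nu> t I)) K"
proof -
  define X where "X = (SIGMA t:T. evars (fst t))"
  have inj: "inj_on (\<lambda>(t, z). \<nu> t z) X"
    using fresh by (simp add: fresh_nulls_def X_def)
  have "\<forall>t\<in>T. \<exists>h'. map_option g \<circ> snd t \<subseteq>\<^sub>m h' \<and> dom h' = uvars (fst t) \<union> evars (fst t) \<and>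
      facts_of h' (head (fst t)) \<subseteq> K"
    using sat by (force simp: satisfied_def)
  then obtain H where H: "\<And>t. t \<in> T \<Longrightarrow> map_option g \<circ> snd t \<subseteq>\<^sub>m H t"
    "\<And>t. t \<in> T \<Longrightarrow> facts_of (H t) (head (fst t)) \<subseteq> K"
    by metis
  define g' where "g' v = (case v of Const c \<Rightarrow> Const c | Null n \<Rightarrow>
      if n \<in> (\<lambda>(t, z). \<nu> t z) ` X then
        (case inv_into X (\<lambda>(t, z). \<nu> t z) n of (t, z) \<Rightarrow> the (H t z))
      else g (Null n))" for v
  have g'_new: "g' (Null (\<nu> t z)) = the (H t z)" if "t \<in> T" "z \<in> evars (fst t)" for t z
  proof -
    have X: "(t, z) \<in> X" using that by (simp add: X_def)
    have "inv_into X (\<lambda>(t, z). \<nu> t z) (\<nu> t z) = (t, z)"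
      using inv_into_f_f [OF inj X] by simp
    moreover have "\<nu> t z \<in> (\<lambda>(t, z). \<nu> t z) ` X"
      using X by force
    ultimately show ?thesis by (simp add: g'_def)
  qed
  have g'_old: "g' v = g v" if "v \<in> vals I" for v
  proof (cases v)
    case (Const c)
    then show ?thesis using g by (simp add: g'_def chom_def)
  next
    case (Null n)
    then have "n \<notin> (\<lambda>(t, z). \<nu> t z) ` X"
      using that fresh by (auto simp: X_def fresh_nulls_def)
    then show ?thesis using Null by (simp add: g'_def)
  qed
  have g'_const: "g' (Const c) = Const c" for c
    by (simp add: g'_def)
  have "map_atom g' a = map_atom g a" if "a \<in> I" for a
    using that by (auto intro!: atom.map_cong0 g'_old simp: vals_def)
  then have I: "map_atom g' ` I \<subseteq> K"
    using g by (auto simp: chom_def)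
  have "map_atom g' ` fire \<nu> t I \<subseteq> K" if t: "t \<in> T" for t
  proof -
    obtain \<xi> h where th: "t = (\<xi>, h)" by fastforce
    define k where "k = (\<lambda>z. if z \<in> evars \<xi> then Some (Null (\<nu> (\<xi>, h) z)) else h z)"
    have "facts_of (H t) (head \<xi>) = map_atom g' ` facts_of k (head \<xi>)"
    proof (rule facts_of_image [OF g'_const])
      fix x assume x: "x \<in> vars (head \<xi>)"
      show "the (H t x) = g' (the (k x))"
      proof (cases "x \<in> evars \<xi>")
        case True
        then show ?thesis using g'_new [of t x] t by (simp add: th k_def)
      next
        case False
        then have u: "x \<in> uvars \<xi>" using x vars_head by blast
        have tr: "dom h = uvars \<xi>" "facts_of h (body \<xi>) \<subseteq> I"
          using T t by (auto simp: th triggers_def)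
        then have "g' (the (h x)) = g (the (h x))"
          using u by (intro g'_old vars_in_vals) (auto simp: uvars_def)
        moreover obtain v where "h x = Some v" using u tr(1) by auto
        moreover from this have "H t x = Some (g v)"
          using H(1) [OF t] by (force simp: th map_le_def)
        ultimately show ?thesis using False by (simp add: k_def)
      qed
    qed
    then show ?thesis using H(2) [OF t] I by (simp add: th image_Un flip: k_def)
  qed
  then have "chom g' (I \<union> (\<Union>t\<in>T. fire \<nu> t I)) K"
    using I g'_const by (auto simp: chom_def)
  then show ?thesis by (auto simp: maps_to_def)
qed

section \<open>Chase steps and their universal property\<close>

definition fire_all :: "tgd set \<Rightarrow> (trigger \<Rightarrow> nat \<Rightarrow> nat) \<Rightarrow> fact set \<Rightarrow> fact set" where
  "fire_all \<Sigma> \<nu> I = I \<union> (\<Union>t\<in>active_triggers \<Sigma> I. fire \<nu> t I)"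

definition chase_step :: "tgd set \<Rightarrow> fact set \<Rightarrow> fact set \<Rightarrow> bool" where
  "chase_step \<Sigma> I J \<longleftrightarrow> (\<exists>\<nu>. fresh_nulls I (active_triggers \<Sigma> I) \<nu> \<and> J = fire_all \<Sigma> \<nu> I)"

text \<open>Covers chase steps both with and without taking cores.\<close>

definition retract_step :: "tgd set \<Rightarrow> fact set \<Rightarrow> fact set \<Rightarrow> bool" where
  "retract_step \<Sigma> I J \<longleftrightarrow> (\<exists>\<nu>. fresh_nulls I (active_triggers \<Sigma> I) \<nu> \<and>
     J \<subseteq> fire_all \<Sigma> \<nu> I \<and> maps_to (fire_all \<Sigma> \<nu> I) J)"

lemma retract_step_if_chase_step: "chase_step \<Sigma> I J \<Longrightarrow> retract_step \<Sigma> I J"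
  by (auto simp: chase_step_def retract_step_def maps_to_subset)

lemma retract_step_if_core_chase_step:
  assumes "core_chase_step \<Sigma> I J"
  shows "retract_step \<Sigma> I J"
proof -
  obtain \<nu> h where "fresh_nulls I (active_triggers \<Sigma> I) \<nu>" "J \<subseteq> fire_all \<Sigma> \<nu> I"
    and h: "endomorphism h (fire_all \<Sigma> \<nu> I)" "map_atom h ` fire_all \<Sigma> \<nu> I \<subseteq> J"
    using assms by (auto simp: core_chase_step_def is_core_def fire_all_def)
  moreover have "homomorphism h (fire_all \<Sigma> \<nu> I) J"
    using h by (simp add: homomorphism_def)
  ultimately show ?thesis
    using chom_if_homomorphism unfolding retract_step_def maps_to_def by blast
qed

lemma satisfied_fire:
  assumes "(\<xi>, h) \<in> triggers \<Sigma> I"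
  shows "satisfied \<xi> h (fire \<nu> (\<xi>, h) I)"
proof -
  define k where "k = (\<lambda>z. if z \<in> evars \<xi> then Some (Null (\<nu> (\<xi>, h) z)) else h z)"
  have dom: "dom h = uvars \<xi>" using assms by (simp add: triggers_def)
  then have "h \<subseteq>\<^sub>m k" using not_uvars_if_evars by (auto simp: map_le_def k_def)
  moreover have "dom k = uvars \<xi> \<union> evars \<xi>"
    using dom by (auto simp: k_def dom_def)
  ultimately show ?thesis unfolding satisfied_def by (auto simp: k_def)
qed

lemma satisfied_fire_all:
  assumes "(\<xi>, h) \<in> triggers \<Sigma> I"
  shows "satisfied \<xi> h (fire_all \<Sigma> \<nu> I)"
proof (cases "satisfied \<xi> h I")
  case True
  moreover have "I \<subseteq> fire_all \<Sigma> \<nu> I" by (simp add: fire_all_def)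
  ultimately show ?thesis using satisfied_mono by blast
next
  case False
  then have "(\<xi>, h) \<in> active_triggers \<Sigma> I"
    using assms by (simp add: active_triggers_eq)
  then have "fire \<nu> (\<xi>, h) I \<subseteq> fire_all \<Sigma> \<nu> I"
    unfolding fire_all_def by blast
  then show ?thesis using satisfied_fire [OF assms] satisfied_mono by blast
qed

text \<open>Firing satisfies every trigger on \<open>I\<close>, and the retraction carries the
  satisfied heads into \<open>J\<close>. It may move values of \<open>I\<close>, which is why the
  triggers have to be composed with it.\<close>

lemma retract_step_satisfies:
  assumes "retract_step \<Sigma> I J"
  obtains r where "chom r I J"
    "\<And>\<xi> h. (\<xi>, h) \<in> triggers \<Sigma> I \<Longrightarrow> satisfied \<xi> (map_option r \<circ> h) J"
proof -
  obtain \<nu> r where r: "chom r (fire_all \<Sigma> \<nu> I) J"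
    using assms by (auto simp: retract_step_def maps_to_def)
  have I: "I \<subseteq> fire_all \<Sigma> \<nu> I" by (simp add: fire_all_def)
  show ?thesis
  proof (rule that)
    show "chom r I J" using r I order_refl by (rule chom_mono)
    show "satisfied \<xi> (map_option r \<circ> h) J" if "(\<xi>, h) \<in> triggers \<Sigma> I" for \<xi> h
      using satisfied_fire_all [OF that] r by (rule satisfied_chom)
  qed
qed

lemma finite_subset_incseq_UN:
  assumes incr: "\<And>n. t n \<subseteq> t (Suc n)" and "finite A" "A \<subseteq> (\<Union>n::nat. t n)"
  shows "\<exists>n. A \<subseteq> t n"
proof -
  have "\<forall>a\<in>A. \<exists>n. a \<in> t n" using assms(3) by blast
  then obtain f where f: "\<forall>a\<in>A. a \<in> t (f a)" by metis
  have "a \<in> t (Max (f ` A))" if "a \<in> A" for a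
  proof -
    have "t (f a) \<subseteq> t (Max (f ` A))"
      using that \<open>finite A\<close> by (intro lift_Suc_mono_le [of t, OF incr]) simp
    then show ?thesis using f that by blast
  qed
  then show ?thesis by blast
qed

lemma chase_step_incr: "chase_step \<Sigma> I J \<Longrightarrow> I \<subseteq> J"
  by (auto simp: chase_step_def fire_all_def)

text \<open>A body is finite and hence matched at some stage, and the next stage satisfies its head.
  In the limit a chain of successors can be followed indefinitely without counting stages; finite
  sets of facts found there are pulled back to a stage by
  \<open>finite_subset_incseq_UN\<close>.\<close>

lemma chase_limit_model:
  assumes t: "\<And>n. chase_step \<Sigma> (t n) (t (Suc n))"
  shows "active_triggers \<Sigma> (\<Union>n. t n) = {}"
proof -
  have "satisfied \<xi> h (\<Union>n. t n)" if trigger: "(\<xi>, h) \<in> triggers \<Sigma> (\<Union>n. t n)" for \<xi> h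
  proof -
    have tr: "\<xi> \<in> \<Sigma>" "dom h = uvars \<xi>" "facts_of h (body \<xi>) \<subseteq> (\<Union>n. t n)"
      using trigger by (simp_all add: triggers_def)
    have "finite (facts_of h (body \<xi>))" by (simp add: facts_of_def)
    then obtain n where "facts_of h (body \<xi>) \<subseteq> t n"
      using finite_subset_incseq_UN [OF chase_step_incr [OF t] _ tr(3)] by blast
    then have "(\<xi>, h) \<in> triggers \<Sigma> (t n)" using tr by (simp add: triggers_def)
    moreover obtain \<nu> where "t (Suc n) = fire_all \<Sigma> \<nu> (t n)"
      using t [of n] by (auto simp: chase_step_def)
    ultimately have "satisfied \<xi> h (t (Suc n))" by (simp add: satisfied_fire_all)
    then show ?thesis by (rule satisfied_mono) blast
  qed
  then show ?thesis by (auto simp: active_triggers_eq)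
qed

text \<open>Images of triggers on \<open>I\<close> are triggers on \<open>M\<close>, where they are
  satisfied, and this supplies witnesses for the fresh nulls. \<open>M\<close> may be infinite, as
  the standard model of arithmetic below is.\<close>

lemma retract_step_maps_to_model:
  assumes "retract_step \<Sigma> I J" "maps_to I M" "active_triggers \<Sigma> M = {}"
  shows "maps_to J M"
proof -
  obtain \<nu> where \<nu>: "fresh_nulls I (active_triggers \<Sigma> I) \<nu>" "J \<subseteq> fire_all \<Sigma> \<nu> I"
    using assms(1) by (auto simp: retract_step_def)
  obtain g where g: "chom g I M" using assms(2) by (auto simp: maps_to_def)
  have "maps_to (fire_all \<Sigma> \<nu> I) M"
    unfolding fire_all_def
  proof (rule chom_extend_fire [OF g _ \<nu>(1)])
    show "active_triggers \<Sigma> I \<subseteq> triggers \<Sigma> I" by (auto simp: active_triggers_def)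
    show "satisfied \<xi> (map_option g \<circ> h) M" if "(\<xi>, h) \<in> active_triggers \<Sigma> I" for \<xi> h
    proof -
      have "(\<xi>, map_option g \<circ> h) \<in> triggers \<Sigma> M"
        using that triggers_chom [OF _ g] by (simp add: active_triggers_eq)
      then show ?thesis using assms(3) by (auto simp: active_triggers_eq)
    qed
  qed
  then show ?thesis using \<nu>(2) maps_to_subset maps_to_trans by blast
qed

text \<open>The argument for models, with witnesses now supplied by the second step, which satisfies
  the images of all triggers on \<open>I\<close>. Used in both directions, it keeps the chase with
  cores and the chase without them equivalent at every stage.\<close>

lemma retract_step_mono:
  assumes "retract_step \<Sigma> I J" "retract_step \<Sigma> I' J'" "maps_to I I'"
  shows "maps_to J J'"
proof -
  obtain \<nu> where \<nu>: "fresh_nulls I (active_triggers \<Sigma> I) \<nu>" "J \<subseteq> fire_all \<Sigma> \<nu> I"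
    using assms(1) by (auto simp: retract_step_def)
  obtain r where r: "chom r I' J'"
    "\<And>\<xi> h. (\<xi>, h) \<in> triggers \<Sigma> I' \<Longrightarrow> satisfied \<xi> (map_option r \<circ> h) J'"
    using retract_step_satisfies [OF assms(2)] by blast
  obtain g where g: "chom g I I'" using assms(3) by (auto simp: maps_to_def)
  have "maps_to (fire_all \<Sigma> \<nu> I) J'"
    unfolding fire_all_def
  proof (rule chom_extend_fire [OF chom_comp [OF g r(1)] _ \<nu>(1)])
    show "active_triggers \<Sigma> I \<subseteq> triggers \<Sigma> I" by (auto simp: active_triggers_def)
    show "satisfied \<xi> (map_option (r \<circ> g) \<circ> h) J'" if "(\<xi>, h) \<in> active_triggers \<Sigma> I" for \<xi> h
      using that r(2) [OF triggers_chom [OF _ g]]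
      by (auto simp: active_triggers_eq comp_assoc option.map_comp fun_eq_iff comp_def)
  qed
  then show ?thesis using \<nu>(2) maps_to_subset maps_to_trans by blast
qed

lemma model_if_equivalent_core:
  assumes "finite J" and core: "\<nexists>g. endomorphism g J \<and> map_atom g ` J \<subset> J"
    and M: "active_triggers \<Sigma> M = {}" and "maps_to J M" "maps_to M J"
  shows "active_triggers \<Sigma> J = {}"
proof -
  obtain a b where a: "chom a J M" and b: "chom b M J"
    using assms by (auto simp: maps_to_def)
  txt \<open>On the finite core \<open>J\<close>, the composite \<open>J \<rightarrow> M \<rightarrow> J\<close> is invertible, so \<open>J\<close> is a retract of \<open>M\<close>.\<close>
  define g where "g = b \<circ> a"
  have g: "chom g J J" using chom_comp [OF a b] by (simp add: g_def)
  have surj: "map_atom g ` J = J"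
    using core homomorphism_if_chom [OF g] g by (auto simp: chom_def)
  then have "g ` vals J = vals J" by (simp flip: vals_image)
  then have inj: "inj_on g (vals J)"
    using finite_vals [OF \<open>finite J\<close>] by (simp add: eq_card_imp_inj_on)
  define k where "k v = (case v of Const c \<Rightarrow> Const c | Null n \<Rightarrow> inv_into (vals J) g (Null n))" for v
  have kg: "k (g v) = v" if "v \<in> vals J" for v
  proof (cases "g v")
    case (Const c)
    \<comment> \<open>A null cannot be sent to a constant: by surjectivity the constant occurs in
      \<open>J\<close>, and it is already its own image.\<close>
    then have "Const c \<in> vals J" using that \<open>g ` vals J = vals J\<close> by force
    then have "v = Const c"
      using inj that Const g by (auto simp: chom_def inj_on_def)
    then show ?thesis using Const by (simp add: k_def)
  next
    case (Null n)
    then show ?thesis using inv_into_f_f [OF inj that] by (simp add: k_def)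
  qed
  have k: "chom k J J"
    unfolding chom_def
  proof (intro conjI allI subsetI)
    fix x assume "x \<in> map_atom k ` J"
    then obtain y where y: "y \<in> J" "x = map_atom k y" by blast
    \<comment> \<open>Every fact of \<open>J\<close> is the image of a fact of \<open>J\<close>, so
      the inverse on values preserves facts as well.\<close>
    then obtain z where z: "z \<in> J" "y = map_atom g z" using surj by blast
    have "map_atom (k \<circ> g) z = map_atom id z"
      using z(1) kg by (intro atom.map_cong0) (auto simp: vals_def)
    then show "x \<in> J" using y z by (simp add: atom.map_comp atom.map_id)
  qed (simp add: k_def)
  have "satisfied \<xi> h J" if "(\<xi>, h) \<in> triggers \<Sigma> J" for \<xi> h
  proof -
    have "satisfied \<xi> (map_option a \<circ> h) M"
      using triggers_chom [OF that a] M by (auto simp: active_triggers_eq)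
    then have "satisfied \<xi> (map_option (k \<circ> b) \<circ> (map_option a \<circ> h)) J"
      using satisfied_chom chom_comp [OF b k] by blast
    moreover have "map_option (k \<circ> b) \<circ> (map_option a \<circ> h) = h"
    proof
      fix x
      show "(map_option (k \<circ> b) \<circ> (map_option a \<circ> h)) x = h x"
      proof (cases "h x")
        case (Some v)
        then have "x \<in> vars (body \<xi>)" using that by (auto simp: triggers_def uvars_def)
        then have "the (h x) \<in> vals J"
          using that vars_in_vals by (auto simp: triggers_def)
        then show ?thesis using Some kg by (simp add: g_def)
      qed simp
    qed
    ultimately show ?thesis by simp
  qed
  then show ?thesis by (auto simp: active_triggers_eq)
qed

section \<open>Existence of cores and of chase sequences\<close>

lemma finite_active_triggers:
  assumes "finite \<Sigma>" "finite I"
  shows "finite (active_triggers \<Sigma> I)"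
proof -
  have "active_triggers \<Sigma> I \<subseteq> (SIGMA \<xi>:\<Sigma>. {h. dom h = uvars \<xi> \<and> ran h \<subseteq> vals I})"
  proof
    fix t assume "t \<in> active_triggers \<Sigma> I"
    moreover obtain \<xi> h where t: "t = (\<xi>, h)" by fastforce
    ultimately have h: "\<xi> \<in> \<Sigma>" "dom h = uvars \<xi>" "facts_of h (body \<xi>) \<subseteq> I"
      by (auto simp: active_triggers_def triggers_def)
    have "v \<in> vals I" if "h x = Some v" for x v
      using vars_in_vals [OF h(3), of x] that h(2) by (auto simp: uvars_def)
    then show "t \<in> (SIGMA \<xi>:\<Sigma>. {h. dom h = uvars \<xi> \<and> ran h \<subseteq> vals I})"
      using h by (auto simp: ran_def t)
  qed
  moreover have "finite (SIGMA \<xi>:\<Sigma>. {h. dom h = uvars \<xi> \<and> ran h \<subseteq> vals I})"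
    using assms
    by (intro finite_SigmaI finite_set_of_finite_maps) (auto simp: uvars_def finite_vars finite_vals)
  ultimately show ?thesis by (rule finite_subset)
qed

lemma fresh_nulls_exist:
  assumes "finite \<Sigma>" "finite I"
  shows "\<exists>\<nu>. fresh_nulls I (active_triggers \<Sigma> I) \<nu>"
proof -
  define X where "X = (SIGMA t:active_triggers \<Sigma> I. evars (fst t))"
  have "finite X"
    using assms by (auto simp: X_def evars_def finite_vars finite_active_triggers)
  then obtain f :: "trigger \<times> nat \<Rightarrow> nat" where f: "inj_on f X"
    using finite_imp_inj_to_nat_seg by blast
  have "finite (Null -` vals I)"
    using assms by (intro finite_vimageI finite_vals) (auto simp: inj_def)
  then obtain m where "\<forall>n\<in>Null -` vals I. n < m"
    using finite_nat_set_iff_bounded by blast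
  then have m: "n < m" if "Null n \<in> vals I" for n
    using that by blast
  have "inj_on (\<lambda>(t, z). f (t, z) + m) X"
    using f by (auto simp: inj_on_def)
  moreover have "Null (f (t, z) + m) \<notin> vals I" for t z
    using m by force
  ultimately show ?thesis
    unfolding fresh_nulls_def X_def by (intro exI [of _ "\<lambda>t z. f (t, z) + m"]) simp
qed

lemma finite_fire_all:
  assumes "finite \<Sigma>" "finite I"
  shows "finite (fire_all \<Sigma> \<nu> I)"
proof -
  have "finite (fire \<nu> t I)" for t
    using assms by (cases t) (simp add: facts_of_def)
  then show ?thesis using assms by (simp add: fire_all_def finite_active_triggers)
qed

text \<open>Among the subsets of \<open>U\<close> into which \<open>U\<close> maps, one with the
  fewest facts is a core: an endomorphism that shrinks it properly would yield a smaller subset of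
  this kind.\<close>

lemma core_exists:
  assumes "finite U"
  shows "\<exists>J. is_core J U"
proof -
  define P where "P J \<longleftrightarrow> J \<subseteq> U \<and> maps_to U J" for J
  have "P U" by (simp add: P_def maps_to_subset)
  then obtain J where J: "P J" "\<And>K. P K \<Longrightarrow> card J \<le> card K"
    using arg_min_nat_lemma [of P U card] by blast
  obtain h where h: "chom h U J" using J(1) by (auto simp: P_def maps_to_def)
  have "\<not> map_atom g ` J \<subset> J" if g: "endomorphism g J" for g
  proof
    assume *: "map_atom g ` J \<subset> J"
    have "homomorphism g J (map_atom g ` J)" using g by (simp add: homomorphism_def)
    then have "maps_to J (map_atom g ` J)" using chom_if_homomorphism maps_to_def by blast
    then have "P (map_atom g ` J)"
      using J(1) * maps_to_trans unfolding P_def by blast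
    moreover have "card (map_atom g ` J) < card J"
      using * assms J(1) finite_subset by (intro psubset_card_mono) (auto simp: P_def)
    ultimately show False using J(2) by fastforce
  qed
  moreover have "endomorphism h U" "map_atom h ` U \<subseteq> J"
    using h J(1) homomorphism_if_chom [OF chom_mono [OF h order_refl]] by (auto simp: P_def chom_def)
  ultimately have "is_core J U"
    using J(1) by (auto simp: is_core_def P_def)
  then show ?thesis ..
qed

lemma core_chase_sequence_exists:
  assumes "finite \<Sigma>" "finite I"
  shows "\<exists>s. core_chase_sequence \<Sigma> I s"
proof -
  \<comment> \<open>Finiteness is kept as an invariant because the existence of fresh nulls and of
    cores is shown for finite instances; the clause for 0 fixes the start.\<close>
  have "\<exists>s. \<forall>n. (finite (s n) \<and> (n = 0 \<longrightarrow> s n = I)) \<and> core_chase_step \<Sigma> (s n) (s (Suc n))"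
  proof (rule dependent_nat_choice)
    fix K :: "fact set" and n :: nat
    assume "finite K \<and> (n = 0 \<longrightarrow> K = I)"
    then have K: "finite K" by simp
    obtain \<nu> where "fresh_nulls K (active_triggers \<Sigma> K) \<nu>"
      using fresh_nulls_exist [OF assms(1) K] by blast
    moreover obtain J where "is_core J (fire_all \<Sigma> \<nu> K)"
      using core_exists finite_fire_all [OF assms(1) K] by blast
    moreover from this have "finite J"
      using finite_fire_all [OF assms(1) K] finite_subset by (auto simp: is_core_def)
    ultimately show "\<exists>J. (finite J \<and> (Suc n = 0 \<longrightarrow> J = I)) \<and> core_chase_step \<Sigma> K J"
      by (auto simp: core_chase_step_def fire_all_def)
  qed (use assms in auto)
  then show ?thesis by (auto simp: core_chase_sequence_def)
qed

lemma chase_sequence_exists: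
  assumes "finite \<Sigma>" "finite I"
  shows "\<exists>t. t 0 = I \<and> (\<forall>n. chase_step \<Sigma> (t n) (t (Suc n)))"
proof -
  have "\<exists>t. \<forall>n. (finite (t n) \<and> (n = 0 \<longrightarrow> t n = I)) \<and> chase_step \<Sigma> (t n) (t (Suc n))"
  proof (rule dependent_nat_choice)
    fix K :: "fact set" and n :: nat
    assume "finite K \<and> (n = 0 \<longrightarrow> K = I)"
    then have K: "finite K" by simp
    obtain \<nu> where "fresh_nulls K (active_triggers \<Sigma> K) \<nu>"
      using fresh_nulls_exist [OF assms(1) K] by blast
    then show "\<exists>J. (finite J \<and> (Suc n = 0 \<longrightarrow> J = I)) \<and> chase_step \<Sigma> K J"
      using finite_fire_all [OF assms(1) K] by (auto simp: chase_step_def)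
  qed (use assms in auto)
  then show ?thesis by auto
qed

lemma core_chase_sequence_finite:
  assumes "finite \<Sigma>" "finite I" "core_chase_sequence \<Sigma> I s"
  shows "finite (s n)"
proof (induction n)
  case (Suc n)
  have "core_chase_step \<Sigma> (s n) (s (Suc n))"
    using assms(3) by (simp add: core_chase_sequence_def)
  then obtain \<nu> where "is_core (s (Suc n)) (fire_all \<Sigma> \<nu> (s n))"
    by (auto simp: core_chase_step_def fire_all_def)
  then show ?case
    using finite_fire_all [OF assms(1) Suc] finite_subset by (auto simp: is_core_def)
qed (use assms in \<open>simp add: core_chase_sequence_def\<close>)

text \<open>A terminal stage of the core chase is itself such an \<open>M\<close>. Conversely, all
  stages of the core chase map to the model \<open>M\<close>, while \<open>M\<close> maps to stage n
  of the chase without cores and from there to stages n and n + 1 of the core chase. Stage n + 1 is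
  thus a finite core equivalent to a model, hence a model.\<close>

theorem core_chase_terminates_iff:
  assumes fin: "finite \<Sigma>" "finite I"
    and t: "t 0 = I" "\<And>n. chase_step \<Sigma> (t n) (t (Suc n))"
  shows "core_chase_terminates \<Sigma> I \<longleftrightarrow>
    (\<exists>n M. finite M \<and> active_triggers \<Sigma> M = {} \<and> maps_to I M \<and> maps_to M (t n))"
proof
  have core_step: "core_chase_step \<Sigma> (s n) (s (Suc n))" if "core_chase_sequence \<Sigma> I s" for s n
    using that by (simp add: core_chase_sequence_def)
  note s_step = retract_step_if_core_chase_step [OF core_step]
  note t_step = retract_step_if_chase_step [OF t(2)]
  {
    assume "core_chase_terminates \<Sigma> I"
    \<comment> \<open>Termination speaks of all sequences, so a sequence has to exist for it to
      yield a terminal stage.\<close>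
    obtain s where s: "core_chase_sequence \<Sigma> I s"
      using core_chase_sequence_exists [OF fin] by blast
    then obtain n where n: "active_triggers \<Sigma> (s n) = {}"
      using \<open>core_chase_terminates \<Sigma> I\<close> by (auto simp: core_chase_terminates_def)
    have "maps_to I (s n)" for n
    proof (induction n)
      case 0
      show ?case using s by (simp add: core_chase_sequence_def maps_to_subset)
    next
      case (Suc n)
      have "maps_to (s n) (s (Suc n))"
        using retract_step_satisfies [OF s_step [OF s]] maps_to_def by metis
      then show ?case using Suc maps_to_trans by blast
    qed
    moreover have "maps_to (s n) (t n)" for n
    proof (induction n)
      case 0
      show ?case using s t(1) by (simp add: core_chase_sequence_def maps_to_subset)
    qed (rule retract_step_mono [OF s_step [OF s] t_step])
    ultimately show "\<exists>n M. finite M \<and> active_triggers \<Sigma> M = {} \<and> maps_to I M \<and> maps_to M (t n)"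
      using n core_chase_sequence_finite [OF fin s] by blast
  next
    assume "\<exists>n M. finite M \<and> active_triggers \<Sigma> M = {} \<and> maps_to I M \<and> maps_to M (t n)"
    then obtain n M where M: "active_triggers \<Sigma> M = {}" "maps_to I M" "maps_to M (t n)"
      by blast
    show "core_chase_terminates \<Sigma> I"
      unfolding core_chase_terminates_def
    proof (intro allI impI)
      fix s assume s: "core_chase_sequence \<Sigma> I s"
      have "maps_to (s n) M" for n
      proof (induction n)
        case 0
        show ?case using s M(2) by (simp add: core_chase_sequence_def)
      qed (rule retract_step_maps_to_model [OF s_step [OF s] _ M(1)])
      moreover have "maps_to (t n) (s n)" for n
      proof (induction n)
        case 0
        show ?case using s t(1) by (simp add: core_chase_sequence_def maps_to_subset)
      qed (rule retract_step_mono [OF t_step s_step [OF s]])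
      \<comment> \<open>The stage after n is used because stage 0 is \<open>I\<close> itself, which
        need not be a core.\<close>
      moreover have "maps_to (s n) (s (Suc n))"
        using retract_step_satisfies [OF s_step [OF s]] maps_to_def by metis
      ultimately have "maps_to (s (Suc n)) M" "maps_to M (s (Suc n))"
        using M(3) maps_to_trans by blast+
      moreover have "\<nexists>g. endomorphism g (s (Suc n)) \<and> map_atom g ` s (Suc n) \<subset> s (Suc n)"
        using core_step [OF s, of n] unfolding core_chase_step_def is_core_def by blast
      ultimately have "active_triggers \<Sigma> (s (Suc n)) = {}"
        using model_if_equivalent_core core_chase_sequence_finite [OF fin s] M(1) by blast
      then show "\<exists>i. active_triggers \<Sigma> (s i) = {}" by blast
    qed
  }
qed

section \<open>Firing one trigger at a time\<close>

inductive reachable :: "tgd set \<Rightarrow> fact set \<Rightarrow> fact set \<Rightarrow> bool" for \<Sigma> I where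
  start: "reachable \<Sigma> I I"
| fire: "reachable \<Sigma> I J \<Longrightarrow> \<xi> \<in> \<Sigma> \<Longrightarrow> facts_of (\<lambda>x. Some (h x)) (body \<xi>) \<subseteq> J \<Longrightarrow>
    inj_on h (evars \<xi>) \<Longrightarrow> (\<forall>z\<in>evars \<xi>. \<exists>n. h z = Null n \<and> Null n \<notin> vals J) \<Longrightarrow>
    reachable \<Sigma> I (J \<union> facts_of (\<lambda>x. Some (h x)) (head \<xi>))"

text \<open>In \<open>reachable\<close>, triggers may be fired even if they are satisfied, so that a
  run is just a list of choices. Up to homomorphism this leads to nothing new: stage n + 1 of the
  chase satisfies all triggers on stage n, which provides images for the fresh nulls.\<close>

lemma reachable_maps_to_chase:
  assumes "reachable \<Sigma> I J" and t: "t 0 = I" "\<And>n. chase_step \<Sigma> (t n) (t (Suc n))"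
  shows "\<exists>n. maps_to J (t n)"
  using assms(1)
proof induction
  case start
  have "maps_to I (t 0)" using t(1) by (simp add: maps_to_subset)
  then show ?case by blast
next
  case (fire J \<xi> h)
  then obtain n g where g: "chom g J (t n)" by (auto simp: maps_to_def)
  obtain r where r: "chom r (t n) (t (Suc n))"
    "\<And>\<xi> h. (\<xi>, h) \<in> triggers \<Sigma> (t n) \<Longrightarrow> satisfied \<xi> (map_option r \<circ> h) (t (Suc n))"
    using retract_step_satisfies [OF retract_step_if_chase_step [OF t(2)]] by blast
  define h' where "h' = (\<lambda>x. Some (h x)) |` uvars \<xi>"
  \<comment> \<open>The value 0 is a dummy: \<open>h\<close> sends existential variables to
    nulls.\<close>
  define \<nu> where "\<nu> t z = (case h z of Const c \<Rightarrow> 0 | Null n \<Rightarrow> n)" for t :: trigger and z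
  have "facts_of h' (body \<xi>) = facts_of (\<lambda>x. Some (h x)) (body \<xi>)"
    by (rule facts_of_cong) (simp add: h'_def uvars_def)
  then have tr: "(\<xi>, h') \<in> triggers \<Sigma> J"
    using fire.hyps by (simp add: triggers_def h'_def)
  have \<nu>: "Null (\<nu> u z) = h z \<and> h z \<notin> vals J" if "z \<in> evars \<xi>" for u z
    using fire.hyps(5) that by (auto simp: \<nu>_def)
  have "inj_on (\<lambda>(t, z). \<nu> t z) (SIGMA t:{(\<xi>, h')}. evars (fst t))"
    using fire.hyps(4) \<nu> by (auto simp: inj_on_def) (metis \<nu>_def)
  then have fresh: "fresh_nulls J {(\<xi>, h')} \<nu>"
    using \<nu> by (simp add: fresh_nulls_def)
  have "maps_to (J \<union> (\<Union>t\<in>{(\<xi>, h')}. fire \<nu> t J)) (t (Suc n))"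
  proof (rule chom_extend_fire [OF chom_comp [OF g r(1)] _ fresh])
    show "satisfied \<xi>' (map_option (r \<circ> g) \<circ> k) (t (Suc n))" if "(\<xi>', k) \<in> {(\<xi>, h')}" for \<xi>' k
      using that r(2) [OF triggers_chom [OF tr g]]
      by (auto simp: comp_assoc option.map_comp fun_eq_iff comp_def)
  qed (use tr in auto)
  moreover have "facts_of (\<lambda>z. if z \<in> evars \<xi> then Some (Null (\<nu> (\<xi>, h') z)) else h' z) (head \<xi>)
      = facts_of (\<lambda>x. Some (h x)) (head \<xi>)"
    using \<nu> vars_head [of \<xi>] by (intro facts_of_cong) (auto simp: h'_def)
  ultimately show ?case by auto
qed

text \<open>The triggers of a parallel step can be fired one after the other: their bodies lie in
  \<open>J\<close> and stay matched, and the nulls of one trigger do not occur in what the others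
  add, since all fresh nulls were chosen distinct.\<close>

lemma reachable_chase_step:
  assumes "reachable \<Sigma> I J" "chase_step \<Sigma> J K" "finite \<Sigma>" "finite J"
  shows "reachable \<Sigma> I K"
proof -
  obtain \<nu> where fresh: "fresh_nulls J (active_triggers \<Sigma> J) \<nu>" and K: "K = fire_all \<Sigma> \<nu> J"
    using assms(2) by (auto simp: chase_step_def)
  have "reachable \<Sigma> I (J \<union> (\<Union>t\<in>T. fire \<nu> t J))"
    if "finite T" "T \<subseteq> active_triggers \<Sigma> J" for T
    using that
  proof (induction T)
    case empty
    show ?case using assms(1) by simp
  next
    case (insert t T)
    define L where "L = J \<union> (\<Union>t\<in>T. fire \<nu> t J)"
    obtain \<xi> h where th: "t = (\<xi>, h)" by fastforce
    define k where "k z = (if z \<in> evars \<xi> then Null (\<nu> t z) else the (h z))" for z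
    have tr: "\<xi> \<in> \<Sigma>" "dom h = uvars \<xi>" "facts_of h (body \<xi>) \<subseteq> J"
      using insert.prems by (auto simp: th active_triggers_def triggers_def)
    have body: "facts_of (\<lambda>x. Some (k x)) (body \<xi>) = facts_of h (body \<xi>)"
    proof (rule facts_of_cong)
      fix x assume "x \<in> vars (body \<xi>)"
      then have "x \<in> uvars \<xi>" "x \<in> dom h" by (simp_all add: uvars_def tr(2))
      then show "Some (k x) = h x" using not_uvars_if_evars [of x \<xi>] by (auto simp: k_def)
    qed
    have head: "facts_of (\<lambda>x. Some (k x)) (head \<xi>) =
        facts_of (\<lambda>z. if z \<in> evars \<xi> then Some (Null (\<nu> (\<xi>, h) z)) else h z) (head \<xi>)"
    proof (rule facts_of_cong)
      fix x assume "x \<in> vars (head \<xi>)"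
      then have "x \<in> evars \<xi> \<or> x \<in> dom h" using vars_head tr(2) by blast
      then show "Some (k x) = (if x \<in> evars \<xi> then Some (Null (\<nu> (\<xi>, h) x)) else h x)"
        by (auto simp: k_def th)
    qed
    have inj: "inj_on (\<lambda>(t, z). \<nu> t z) (SIGMA t:active_triggers \<Sigma> J. evars (fst t))"
      using fresh by (simp add: fresh_nulls_def)
    have new: "Null (\<nu> t z) \<notin> vals L" if z: "z \<in> evars \<xi>" for z
    proof
      assume "Null (\<nu> t z) \<in> vals L"
      moreover have "Null (\<nu> t z) \<notin> vals J"
        using fresh insert.prems z by (auto simp: fresh_nulls_def th)
      ultimately obtain t' where "t' \<in> T" "Null (\<nu> t z) \<in> vals (fire \<nu> t' J) - vals J"
        by (auto simp: L_def vals_def)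
      moreover obtain \<xi>' h' where "t' = (\<xi>', h')" by fastforce
      ultimately have t': "(\<xi>', h') \<in> T" "Null (\<nu> t z) \<in> vals (facts_of
          (\<lambda>z. if z \<in> evars \<xi>' then Some (Null (\<nu> (\<xi>', h') z)) else h' z) (head \<xi>'))"
        by (auto simp: vals_def)
      then obtain a u where u: "a \<in> set (head \<xi>')" "u \<in> set_atom a"
        "Null (\<nu> t z) = val_of (\<lambda>z. if z \<in> evars \<xi>' then Some (Null (\<nu> (\<xi>', h') z)) else h' z) u"
        by (auto simp: vals_def facts_of_def atom.set_map)
      then obtain y where y: "u = Var y" "y \<in> vars (head \<xi>')"
        by (cases u) (auto simp: vars_def)
      have t'a: "(\<xi>', h') \<in> active_triggers \<Sigma> J" using t' insert.prems by blast
      then have t'tr: "dom h' = uvars \<xi>'" "facts_of h' (body \<xi>') \<subseteq> J"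
        by (auto simp: active_triggers_def triggers_def)
      show False
      proof (cases "y \<in> evars \<xi>'")
        case True
        have "(t, z) = ((\<xi>', h'), y)"
        proof (rule inj_onD [OF inj])
          show "(case (t, z) of (t, z) \<Rightarrow> \<nu> t z) = (case ((\<xi>', h'), y) of (t, z) \<Rightarrow> \<nu> t z)"
            using True u(3) y by simp
        qed (use True z t'a insert.prems in \<open>auto simp: th\<close>)
        then show False using t'(1) insert.hyps(2) by simp
      next
        case False
        then have "y \<in> vars (body \<xi>')" using y vars_head by (auto simp: uvars_def)
        then have "the (h' y) \<in> vals J" using vars_in_vals t'tr by blast
        then show False using u(3) y False \<open>Null (\<nu> t z) \<notin> vals J\<close> by simp
      qed
    qed
    have "reachable \<Sigma> I (L \<union> facts_of (\<lambda>x. Some (k x)) (head \<xi>))"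
    proof (rule reachable.fire)
      show "reachable \<Sigma> I L" using insert by (simp add: L_def)
      show "facts_of (\<lambda>x. Some (k x)) (body \<xi>) \<subseteq> L"
        unfolding body L_def using tr(3) by blast
      show "inj_on k (evars \<xi>)"
        using inj insert.prems by (auto simp: inj_on_def k_def th)
      show "\<forall>z\<in>evars \<xi>. \<exists>n. k z = Null n \<and> Null n \<notin> vals L"
        using new by (auto simp: k_def)
    qed (rule tr)
    moreover have "L \<union> facts_of (\<lambda>x. Some (k x)) (head \<xi>) = J \<union> (\<Union>t\<in>insert t T. fire \<nu> t J)"
      unfolding head L_def th by auto
    ultimately show ?case by simp
  qed
  then show ?thesis
    using finite_active_triggers [OF assms(3,4)] by (simp add: K fire_all_def)
qed

text \<open>The form used for certificates: \<open>J\<close> is determined by a finite list of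
  choices, and no step has to find all active triggers.\<close>

theorem core_chase_terminates_iff_reachable:
  assumes fin: "finite \<Sigma>" "finite I"
  shows "core_chase_terminates \<Sigma> I \<longleftrightarrow>
    (\<exists>J M. reachable \<Sigma> I J \<and> finite M \<and> active_triggers \<Sigma> M = {} \<and> maps_to I M \<and> maps_to M J)"
proof -
  obtain t where t: "t 0 = I" "\<And>n. chase_step \<Sigma> (t n) (t (Suc n))"
    using chase_sequence_exists [OF fin] by blast
  have "finite (t n) \<and> reachable \<Sigma> I (t n)" for n
  proof (induction n)
    case 0
    show ?case using fin t(1) by (simp add: start)
  next
    case (Suc n)
    then show ?case
      using reachable_chase_step [OF _ t(2) fin(1)] t(2) [of n] finite_fire_all [OF fin(1)]
      by (auto simp: chase_step_def)
  qed
  then show ?thesis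
    unfolding core_chase_terminates_iff [OF fin t]
    using reachable_maps_to_chase [OF _ t] maps_to_trans by metis
qed

section \<open>Recursive enumerability of the membership problem\<close>

text \<open>The codes are those inside \<open>input_encode\<close>, so that inputs of the membership
  problem can be decoded by \<open>dec\<close>. By \<open>sum_encode\<close>, even codes are
  constants and odd ones are nulls, which reduces case distinctions to parity.\<close>

instantiation val :: coded
begin
definition enc_val :: "val \<Rightarrow> nat" where "enc_val = val_encode"
instance
proof
  have "val_encode (case sum_decode n of Inl m \<Rightarrow> Const m | Inr m \<Rightarrow> Null m) = n" for n
    by (cases "even n") (auto simp: sum_decode_def sum_encode_def)
  then have "surj val_encode" by (rule surjI)
  then show "bij (enc :: val \<Rightarrow> nat)" by (simp add: enc_val_def bij_def inj_val_encode)
qed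
end

instantiation trm :: coded
begin
definition enc_trm :: "trm \<Rightarrow> nat" where "enc_trm = trm_encode"
instance
proof
  have "trm_encode (case sum_decode n of Inl m \<Rightarrow> Var m | Inr m \<Rightarrow> Cst m) = n" for n
    by (cases "even n") (auto simp: sum_decode_def sum_encode_def)
  then have "surj trm_encode" by (rule surjI)
  then show "bij (enc :: trm \<Rightarrow> nat)" by (simp add: enc_trm_def bij_def inj_trm_encode)
qed
end

instantiation atom :: (coded) coded
begin
definition enc_atom :: "'a atom \<Rightarrow> nat" where "enc_atom = atom_encode enc"
instance
proof
  have *: "enc a = enc (rel a, args a)" for a :: "'a atom"
    by (simp add: enc_atom_def atom_encode_def enc_list_def)
  show "bij (enc :: 'a atom \<Rightarrow> nat)"
  proof (rule o_bij)
    show "(\<lambda>n. case dec n of (r, as) \<Rightarrow> Atom r as) \<circ> (enc :: 'a atom \<Rightarrow> nat) = id"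
      by (simp only: * fun_eq_iff comp_def dec_enc) simp
    show "(enc :: 'a atom \<Rightarrow> nat) \<circ> (\<lambda>n. case dec n of (r, as) \<Rightarrow> Atom r as) = id"
      by (simp only: * fun_eq_iff comp_def case_prod_unfold atom.sel prod.collapse enc_dec) simp
  qed
qed
end

lemma enc_atom_eq: "enc a = enc (rel a, args a)"
  by (simp add: enc_atom_def atom_encode_def enc_list_def)

instantiation tgd :: coded
begin
definition enc_tgd :: "tgd \<Rightarrow> nat" where "enc_tgd = tgd_encode"
instance
proof
  have *: "enc \<xi> = enc (body \<xi>, head \<xi>)" for \<xi> :: tgd
    by (simp add: enc_tgd_def tgd_encode_def enc_list_def enc_atom_def enc_trm_def)
  show "bij (enc :: tgd \<Rightarrow> nat)"
  proof (rule o_bij)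
    show "(\<lambda>n. case dec n of (b, h) \<Rightarrow> Tgd b h) \<circ> (enc :: tgd \<Rightarrow> nat) = id"
      by (simp only: * fun_eq_iff comp_def dec_enc) simp
    show "(enc :: tgd \<Rightarrow> nat) \<circ> (\<lambda>n. case dec n of (b, h) \<Rightarrow> Tgd b h) = id"
      by (simp only: * fun_eq_iff comp_def case_prod_unfold tgd.sel prod.collapse enc_dec) simp
  qed
qed
end

lemma enc_tgd_eq: "enc \<xi> = enc (body \<xi>, head \<xi>)"
  by (simp add: enc_tgd_def tgd_encode_def enc_list_def enc_atom_def enc_trm_def)

lemma computable_rel [computable_intros]:
  assumes "computable f"
  shows "computable (\<lambda>x. rel (f x))"
proof -
  have "computable (\<lambda>x. (rel (f x), args (f x)))"
    using assms by (rule computable_cong_enc [rotated]) (simp only: enc_atom_eq)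
  from computable_fst [OF this] show ?thesis by simp
qed

lemma computable_args [computable_intros]:
  assumes "computable f"
  shows "computable (\<lambda>x. args (f x))"
proof -
  have "computable (\<lambda>x. (rel (f x), args (f x)))"
    using assms by (rule computable_cong_enc [rotated]) (simp only: enc_atom_eq)
  from computable_snd [OF this] show ?thesis by simp
qed

lemma computable_Atom [computable_intros]:
  assumes "computable f" "computable g"
  shows "computable (\<lambda>x. Atom (f x) (g x))"
  using computable_Pair [OF assms]
  by (rule computable_cong_enc [rotated]) (simp only: enc_atom_eq atom.sel)

lemma computable_map_atom [computable_intros]:
  assumes "computable (\<lambda>p. f (fst p) (snd p))" "computable a"
  shows "computable (\<lambda>x. map_atom (f x) (a x))"
proof -
  have "computable (\<lambda>x. Atom (rel (a x)) (map (f x) (args (a x))))"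
    by (intro computable_intros assms)
  moreover have "map_atom g b = Atom (rel b) (map g (args b))" for g :: "'b \<Rightarrow> 'c" and b
    by (cases b) simp
  ultimately show ?thesis by simp
qed

lemma computable_body [computable_intros]:
  assumes "computable f"
  shows "computable (\<lambda>x. body (f x))"
proof -
  have "computable (\<lambda>x. (body (f x), head (f x)))"
    using assms by (rule computable_cong_enc [rotated]) (simp only: enc_tgd_eq)
  from computable_fst [OF this] show ?thesis by simp
qed

lemma computable_head [computable_intros]:
  assumes "computable f"
  shows "computable (\<lambda>x. head (f x))"
proof -
  have "computable (\<lambda>x. (body (f x), head (f x)))"
    using assms by (rule computable_cong_enc [rotated]) (simp only: enc_tgd_eq)
  from computable_snd [OF this] show ?thesis by simp
qed

lemma computable_case_val [computable_intros]:
  assumes "computable (\<lambda>p. a (fst p) (snd p))" "computable (\<lambda>p. b (fst p) (snd p))" "computable v"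
  shows "computable (\<lambda>x. case v x of Const c \<Rightarrow> a x c | Null n \<Rightarrow> b x n)"
proof -
  have "(case v x of Const c \<Rightarrow> a x c | Null n \<Rightarrow> b x n) =
      (if enc (v x) mod 2 = 0 then a x (enc (v x) div 2) else b x (enc (v x) div 2))" for x
    by (cases "v x") (simp_all add: enc_val_def sum_encode_def)
  then show ?thesis
    by (simp only:) (intro computable_intros assms computable2 [OF assms(1)] computable2 [OF assms(2)])
qed

lemma computable_case_trm [computable_intros]:
  assumes "computable (\<lambda>p. a (fst p) (snd p))" "computable (\<lambda>p. b (fst p) (snd p))" "computable t"
  shows "computable (\<lambda>x. case t x of Var n \<Rightarrow> a x n | Cst c \<Rightarrow> b x c)"
proof -
  have "(case t x of Var n \<Rightarrow> a x n | Cst c \<Rightarrow> b x c) =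
      (if enc (t x) mod 2 = 0 then a x (enc (t x) div 2) else b x (enc (t x) div 2))" for x
    by (cases "t x") (simp_all add: enc_trm_def sum_encode_def)
  then show ?thesis
    by (simp only:) (intro computable_intros assms computable2 [OF assms(1)] computable2 [OF assms(2)])
qed

lemma computable_Const [computable_intros]:
  assumes "computable f"
  shows "computable (\<lambda>x. Const (f x))"
proof -
  have "computable (\<lambda>x. 2 * f x)" by (intro computable_intros assms)
  then show ?thesis by (rule computable_cong_enc [rotated]) (simp add: enc_val_def sum_encode_def)
qed

text \<open>Assignments of values to variables, and to nulls, are represented by lists; entries beyond
  the end of the list are \<open>Const 0\<close>.\<close>

definition lookup :: "val list \<Rightarrow> nat \<Rightarrow> val" where
  "lookup hs n = (case drop n hs of [] \<Rightarrow> Const 0 | v # _ \<Rightarrow> v)"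

lemma lookup_map_upt: "x < n \<Longrightarrow> lookup (map f [0..<n]) x = f x"
  by (simp add: lookup_def flip: Cons_nth_drop_Suc)

lemma computable_lookup [computable_intros]:
  assumes "computable f" "computable g"
  shows "computable (\<lambda>x. lookup (f x) (g x))"
  by (rule computable2 [OF _ assms]) (unfold lookup_def, intro computable_intros)

definition inst_atoms :: "val list \<Rightarrow> trm atom list \<Rightarrow> fact list" where
  "inst_atoms hs = map (map_atom (\<lambda>t. case t of Var x \<Rightarrow> lookup hs x | Cst c \<Rightarrow> Const c))"

lemma set_inst_atoms: "set (inst_atoms hs as) = facts_of (\<lambda>x. Some (lookup hs x)) as"
proof -
  have "val_of (\<lambda>x. Some (lookup hs x)) = (\<lambda>t. case t of Var x \<Rightarrow> lookup hs x | Cst c \<Rightarrow> Const c)"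
    by (auto simp: fun_eq_iff split: trm.split)
  then show ?thesis by (simp add: inst_atoms_def facts_of_def)
qed

lemma computable_inst_atoms [computable_intros]:
  assumes "computable f" "computable g"
  shows "computable (\<lambda>x. inst_atoms (f x) (g x))"
  by (rule computable2 [OF _ assms]) (unfold inst_atoms_def, intro computable_intros)

definition var_list :: "trm atom list \<Rightarrow> nat list" where
  "var_list as =
     concat (map (\<lambda>t. case t of Var x \<Rightarrow> [x] | Cst c \<Rightarrow> []) (concat (map args as)))"

lemma set_args: "set (args a) = set_atom a"
  by (cases a) simp

lemma set_var_list: "set (var_list as) = vars as"
  by (auto simp: var_list_def vars_def set_args split: trm.splits)

lemma computable_var_list [computable_intros]:
  assumes "computable f"
  shows "computable (\<lambda>x. var_list (f x))"
  by (rule computable_comp [OF _ assms]) (unfold var_list_def, intro computable_intros)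

definition evar_list :: "tgd \<Rightarrow> nat list" where
  "evar_list \<xi> = filter (\<lambda>x. \<not> x \<in> set (var_list (body \<xi>))) (var_list (head \<xi>))"

lemma set_evar_list: "set (evar_list \<xi>) = evars \<xi>"
  by (auto simp: evar_list_def evars_def set_var_list)

lemma computable_evar_list [computable_intros]:
  assumes "computable f"
  shows "computable (\<lambda>x. evar_list (f x))"
  by (rule computable_comp [OF _ assms]) (unfold evar_list_def, intro computable_intros)

definition val_list :: "fact list \<Rightarrow> val list" where
  "val_list I = concat (map args I)"

lemma set_val_list: "set (val_list I) = vals (set I)"
  by (simp add: val_list_def vals_def set_args)

lemma computable_val_list [computable_intros]:
  assumes "computable f"
  shows "computable (\<lambda>x. val_list (f x))"
  by (rule computable_comp [OF _ assms]) (unfold val_list_def, intro computable_intros)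

lemma ex_lookup:
  assumes "finite A"
  shows "\<exists>hs. \<forall>x\<in>A. lookup hs x = f x"
proof -
  obtain n where "\<forall>x\<in>A. x < n"
    using assms finite_nat_set_iff_bounded by blast
  then have "\<forall>x\<in>A. lookup (map f [0..<n]) x = f x"
    by (simp add: lookup_map_upt)
  then show ?thesis ..
qed

section \<open>Decidable checks on certificates\<close>

definition hom_check :: "val list \<Rightarrow> fact list \<Rightarrow> fact list \<Rightarrow> bool" where
  "hom_check ps I M \<longleftrightarrow> (\<forall>a\<in>set I.
     map_atom (\<lambda>v. case v of Const c \<Rightarrow> Const c | Null n \<Rightarrow> lookup ps n) a \<in> set M)"

lemma hom_check_iff: "(\<exists>ps. hom_check ps I M) \<longleftrightarrow> maps_to (set I) (set M)"
proof
  assume "\<exists>ps. hom_check ps I M"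
  then obtain ps where "hom_check ps I M" ..
  then have "chom (\<lambda>v. case v of Const c \<Rightarrow> Const c | Null n \<Rightarrow> lookup ps n) (set I) (set M)"
    by (simp add: chom_def hom_check_def image_subset_iff)
  then show "maps_to (set I) (set M)" unfolding maps_to_def by blast
next
  assume "maps_to (set I) (set M)"
  then obtain g where g: "chom g (set I) (set M)" by (auto simp: maps_to_def)
  have "finite (Null -` vals (set I))"
    by (intro finite_vimageI finite_vals) (auto simp: inj_def)
  then obtain ps where ps: "\<forall>n\<in>Null -` vals (set I). lookup ps n = g (Null n)"
    using ex_lookup [of _ "\<lambda>n. g (Null n)"] by blast
  have "map_atom (\<lambda>v. case v of Const c \<Rightarrow> Const c | Null n \<Rightarrow> lookup ps n) a = map_atom g a"
    if a: "a \<in> set I" for a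
  proof (rule atom.map_cong0)
    fix v assume "v \<in> set_atom a"
    then have "v \<in> vals (set I)" using a by (auto simp: vals_def)
    then show "(case v of Const c \<Rightarrow> Const c | Null n \<Rightarrow> lookup ps n) = g v"
      using g ps by (cases v) (auto simp: chom_def)
  qed
  then have "hom_check ps I M"
    using g by (simp add: hom_check_def chom_def image_subset_iff)
  then show "\<exists>ps. hom_check ps I M" ..
qed

text \<open>Quantification over assignments is made bounded: only lists of one length over the
  values in \<open>M\<close> are tried. That length exceeds every variable of the tgd, since a sum
  of naturals bounds its summands. \<open>Const 0\<close> fills the positions of other variables,
  even if \<open>M\<close> is empty.\<close>

definition model_check :: "tgd list \<Rightarrow> fact list \<Rightarrow> bool" where
  "model_check \<Sigma> M \<longleftrightarrow> (\<forall>\<xi>\<in>set \<Sigma>.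
     \<forall>hs\<in>set (List.n_lists (Suc (sum_list (var_list (body \<xi> @ head \<xi>)))) (Const 0 # val_list M)).
       (\<forall>a\<in>set (inst_atoms hs (body \<xi>)). a \<in> set M) \<longrightarrow>
       (\<exists>ks\<in>set (List.n_lists (Suc (sum_list (var_list (body \<xi> @ head \<xi>)))) (Const 0 # val_list M)).
         (\<forall>x\<in>set (var_list (body \<xi>)). lookup ks x = lookup hs x) \<and>
         (\<forall>a\<in>set (inst_atoms ks (head \<xi>)). a \<in> set M)))"

lemma ex_n_lists:
  assumes "\<And>x v. h x = Some v \<Longrightarrow> v \<in> vals (set M)" "\<And>x. x \<in> dom h \<Longrightarrow> x < n"
  shows "\<exists>hs\<in>set (List.n_lists n (Const 0 # val_list M)). \<forall>x\<in>dom h. h x = Some (lookup hs x)"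
proof
  let ?hs = "map (\<lambda>x. case h x of None \<Rightarrow> Const 0 | Some v \<Rightarrow> v) [0..<n]"
  show "?hs \<in> set (List.n_lists n (Const 0 # val_list M))"
    using assms(1) by (auto simp: set_n_lists set_val_list split: option.split)
  show "\<forall>x\<in>dom h. h x = Some (lookup ?hs x)"
    using assms(2) by (auto simp: lookup_map_upt dom_def)
qed

lemma model_check_iff: "model_check \<Sigma> M \<longleftrightarrow> active_triggers (set \<Sigma>) (set M) = {}"
proof -
  define n where "n \<xi> = Suc (sum_list (var_list (body \<xi> @ head \<xi>)))" for \<xi>
  define L where "L \<xi> = set (List.n_lists (n \<xi>) (Const 0 # val_list M))" for \<xi>
  have n: "x < n \<xi>" if "x \<in> uvars \<xi> \<union> evars \<xi>" for x \<xi>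
  proof -
    have "x \<in> set (var_list (body \<xi> @ head \<xi>))"
      using that by (auto simp: set_var_list uvars_def evars_def vars_def)
    then show ?thesis using member_le_sum_list [of x] unfolding n_def by fastforce
  qed
  have eq: "model_check \<Sigma> M \<longleftrightarrow> (\<forall>\<xi>\<in>set \<Sigma>. \<forall>hs\<in>L \<xi>.
      facts_of (\<lambda>x. Some (lookup hs x)) (body \<xi>) \<subseteq> set M \<longrightarrow>
      (\<exists>ks\<in>L \<xi>. (\<forall>x\<in>uvars \<xi>. lookup ks x = lookup hs x) \<and>
         facts_of (\<lambda>x. Some (lookup ks x)) (head \<xi>) \<subseteq> set M))"
    unfolding model_check_def L_def n_def set_inst_atoms set_var_list uvars_def subset_eq ..
  have "satisfied \<xi> h (set M)"
    if M: "model_check \<Sigma> M" and tr: "(\<xi>, h) \<in> triggers (set \<Sigma>) (set M)" for \<xi> h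
  proof -
    have h: "\<xi> \<in> set \<Sigma>" "dom h = uvars \<xi>" "facts_of h (body \<xi>) \<subseteq> set M"
      using tr by (auto simp: triggers_def)
    have "\<exists>hs\<in>L \<xi>. \<forall>x\<in>dom h. h x = Some (lookup hs x)"
      unfolding L_def
    proof (rule ex_n_lists)
      show "v \<in> vals (set M)" if "h x = Some v" for x v
        using vars_in_vals [OF h(3), of x] that h(2) by (auto simp: uvars_def)
    qed (use h(2) n in auto)
    then obtain hs where hs: "hs \<in> L \<xi>" "\<And>x. x \<in> uvars \<xi> \<Longrightarrow> h x = Some (lookup hs x)"
      using h(2) by blast
    have "facts_of (\<lambda>x. Some (lookup hs x)) (body \<xi>) = facts_of h (body \<xi>)"
      using hs(2) by (intro facts_of_cong) (auto simp: uvars_def)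
    then obtain ks where ks: "\<And>x. x \<in> uvars \<xi> \<Longrightarrow> lookup ks x = lookup hs x"
      "facts_of (\<lambda>x. Some (lookup ks x)) (head \<xi>) \<subseteq> set M"
      using M hs(1) h(1,3) unfolding eq by metis
    define h' where "h' = (\<lambda>x. Some (lookup ks x)) |` (uvars \<xi> \<union> evars \<xi>)"
    have "facts_of h' (head \<xi>) = facts_of (\<lambda>x. Some (lookup ks x)) (head \<xi>)"
      using vars_head [of \<xi>] by (intro facts_of_cong) (auto simp: h'_def)
    moreover have "h \<subseteq>\<^sub>m h'"
      using h(2) hs(2) ks(1) by (auto simp: map_le_def h'_def)
    ultimately show ?thesis
      using ks(2) unfolding satisfied_def by (intro exI [of _ h']) (auto simp: h'_def)
  qed
  moreover have "model_check \<Sigma> M"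
    if sat: "\<And>\<xi> h. (\<xi>, h) \<in> triggers (set \<Sigma>) (set M) \<Longrightarrow> satisfied \<xi> h (set M)"
    unfolding eq
  proof (intro ballI impI)
    fix \<xi> hs
    assume \<xi>: "\<xi> \<in> set \<Sigma>" and "hs \<in> L \<xi>"
      and bd: "facts_of (\<lambda>x. Some (lookup hs x)) (body \<xi>) \<subseteq> set M"
    define h where "h = (\<lambda>x. Some (lookup hs x)) |` uvars \<xi>"
    have "facts_of h (body \<xi>) = facts_of (\<lambda>x. Some (lookup hs x)) (body \<xi>)"
      by (intro facts_of_cong) (auto simp: h_def uvars_def)
    then have tr: "(\<xi>, h) \<in> triggers (set \<Sigma>) (set M)"
      using \<xi> bd by (simp add: triggers_def h_def)
    then have "satisfied \<xi> h (set M)" by (rule sat)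
    then obtain h' where h': "h \<subseteq>\<^sub>m h'" "dom h' = uvars \<xi> \<union> evars \<xi>"
      "facts_of h' (head \<xi>) \<subseteq> set M"
      by (auto simp: satisfied_def)
    have le: "h' x = Some (lookup hs x)" if "x \<in> uvars \<xi>" for x
    proof -
      have "x \<in> dom h" using that by (simp add: h_def)
      then have "h x = h' x" using h'(1) by (simp add: map_le_def)
      then show ?thesis using that by (simp add: h_def)
    qed
    have "\<exists>ks\<in>L \<xi>. \<forall>x\<in>dom h'. h' x = Some (lookup ks x)"
      unfolding L_def
    proof (rule ex_n_lists)
      fix x v assume x: "h' x = Some v"
      then consider "x \<in> uvars \<xi>" | "x \<in> evars \<xi>" using h'(2) by blast
      then show "v \<in> vals (set M)"
      proof cases
        case 1
        then show ?thesis using vars_in_vals [OF bd, of x] x le by (simp add: uvars_def)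
      next
        case 2
        then show ?thesis using vars_in_vals [OF h'(3), of x] x by (simp add: evars_def)
      qed
    qed (use h'(2) n in auto)
    then obtain ks where ks: "ks \<in> L \<xi>" "\<And>x. x \<in> dom h' \<Longrightarrow> h' x = Some (lookup ks x)"
      by blast
    have "facts_of (\<lambda>x. Some (lookup ks x)) (head \<xi>) = facts_of h' (head \<xi>)"
    proof (rule facts_of_cong)
      fix x assume "x \<in> vars (head \<xi>)"
      then have "x \<in> dom h'" using vars_head h'(2) by blast
      then show "Some (lookup ks x) = h' x" using ks(2) by simp
    qed
    moreover have "lookup ks x = lookup hs x" if "x \<in> uvars \<xi>" for x
      using le [OF that] ks(2) [of x] that h'(2) by simp
    ultimately show "\<exists>ks\<in>L \<xi>. (\<forall>x\<in>uvars \<xi>. lookup ks x = lookup hs x) \<and>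
         facts_of (\<lambda>x. Some (lookup ks x)) (head \<xi>) \<subseteq> set M"
      using ks(1) h'(3) by auto
  qed
  ultimately show ?thesis by (auto simp: active_triggers_eq)
qed

text \<open>An illegal choice leaves the instance as it is. So every list of choices is a run, and
  the certificate needs no separate check of legality. Odd codes are those of nulls.\<close>

definition fire_step :: "tgd list \<Rightarrow> fact list \<Rightarrow> tgd \<times> val list \<Rightarrow> fact list" where
  "fire_step \<Sigma> J c =
     (if fst c \<in> set \<Sigma> \<and> (\<forall>a\<in>set (inst_atoms (snd c) (body (fst c))). a \<in> set J) \<and>
        (\<forall>z\<in>set (evar_list (fst c)). enc (lookup (snd c) z) mod 2 = 1 \<and>
           \<not> lookup (snd c) z \<in> set (val_list J) \<and>
           (\<forall>y\<in>set (evar_list (fst c)). lookup (snd c) y = lookup (snd c) z \<longrightarrow> y = z))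
      then inst_atoms (snd c) (head (fst c)) @ J else J)"

lemma is_null_iff: "enc v mod 2 = 1 \<longleftrightarrow> (\<exists>n. v = Null n)"
  by (cases v) (simp_all add: enc_val_def sum_encode_def)

lemma reachable_iff: "reachable (set \<Sigma>) (set I) J \<longleftrightarrow> (\<exists>cs. set (foldl (fire_step \<Sigma>) I cs) = J)"
proof
  assume "reachable (set \<Sigma>) (set I) J"
  then show "\<exists>cs. set (foldl (fire_step \<Sigma>) I cs) = J"
  proof induction
    case start
    show ?case by (rule exI [of _ "[]"]) simp
  next
    case (fire J \<xi> h)
    then obtain cs where cs: "set (foldl (fire_step \<Sigma>) I cs) = J" by blast
    obtain hs where hs: "\<And>x. x \<in> uvars \<xi> \<union> evars \<xi> \<Longrightarrow> lookup hs x = h x"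
      using ex_lookup [of "uvars \<xi> \<union> evars \<xi>" h] finite_vars by (auto simp: uvars_def evars_def)
    have bd: "facts_of (\<lambda>x. Some (lookup hs x)) (body \<xi>) = facts_of (\<lambda>x. Some (h x)) (body \<xi>)"
      using hs by (intro facts_of_cong) (auto simp: uvars_def)
    have hd: "facts_of (\<lambda>x. Some (lookup hs x)) (head \<xi>) = facts_of (\<lambda>x. Some (h x)) (head \<xi>)"
      using hs vars_head by (intro facts_of_cong) auto
    have "enc (lookup hs z) mod 2 = 1 \<and> \<not> lookup hs z \<in> vals J \<and>
        (\<forall>y\<in>evars \<xi>. lookup hs y = lookup hs z \<longrightarrow> y = z)" if z: "z \<in> evars \<xi>" for z
    proof -
      obtain n where "h z = Null n" "Null n \<notin> vals J" using fire.hyps(5) z by auto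
      then show ?thesis
        using fire.hyps(4) z hs unfolding is_null_iff by (simp add: inj_on_def)
    qed
    moreover have "\<forall>a\<in>facts_of (\<lambda>x. Some (lookup hs x)) (body \<xi>). a \<in> J"
      using fire.hyps(3) unfolding bd subset_eq .
    ultimately have "fire_step \<Sigma> (foldl (fire_step \<Sigma>) I cs) (\<xi>, hs) =
        inst_atoms hs (head \<xi>) @ foldl (fire_step \<Sigma>) I cs"
      using fire.hyps(2) unfolding fire_step_def fst_conv snd_conv set_inst_atoms set_evar_list
        set_val_list cs by (intro if_P conjI ballI) simp_all
    then have "set (fire_step \<Sigma> (foldl (fire_step \<Sigma>) I cs) (\<xi>, hs)) =
        J \<union> facts_of (\<lambda>x. Some (h x)) (head \<xi>)"
      by (simp add: set_inst_atoms hd cs Un_commute)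
    then show ?case by (intro exI [of _ "cs @ [(\<xi>, hs)]"]) simp
  qed
next
  assume "\<exists>cs. set (foldl (fire_step \<Sigma>) I cs) = J"
  moreover have "reachable (set \<Sigma>) (set I) (set (foldl (fire_step \<Sigma>) I cs))" for cs
  proof (induction cs rule: rev_induct)
    case Nil
    show ?case by (simp add: start)
  next
    case (snoc c cs)
    define J where "J = foldl (fire_step \<Sigma>) I cs"
    have J: "reachable (set \<Sigma>) (set I) (set J)" using snoc by (simp add: J_def)
    have "reachable (set \<Sigma>) (set I) (set (fire_step \<Sigma> J c))"
    proof (cases "fire_step \<Sigma> J c = J")
      case False
      obtain \<xi> hs where c: "c = (\<xi>, hs)" by fastforce
      have C: "\<xi> \<in> set \<Sigma> \<and> (\<forall>a\<in>set (inst_atoms hs (body \<xi>)). a \<in> set J) \<and>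
          (\<forall>z\<in>set (evar_list \<xi>). enc (lookup hs z) mod 2 = 1 \<and>
             \<not> lookup hs z \<in> set (val_list J) \<and>
             (\<forall>y\<in>set (evar_list \<xi>). lookup hs y = lookup hs z \<longrightarrow> y = z))" (is ?C)
      proof (rule ccontr)
        assume "\<not> ?C"
        then have "fire_step \<Sigma> J c = J"
          unfolding fire_step_def c fst_conv snd_conv by (rule if_not_P)
        then show False using False by simp
      qed
      then have f5: "fire_step \<Sigma> J c = inst_atoms hs (head \<xi>) @ J"
        unfolding fire_step_def c fst_conv snd_conv by (rule if_P)
      note C' = C [unfolded set_inst_atoms set_evar_list set_val_list is_null_iff]
      have f: "\<xi> \<in> set \<Sigma>" "facts_of (\<lambda>x. Some (lookup hs x)) (body \<xi>) \<subseteq> set J"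
        "inj_on (lookup hs) (evars \<xi>)"
        using C' by (auto simp: inj_on_def)
      have f4: "\<forall>z\<in>evars \<xi>. \<exists>n. lookup hs z = Null n \<and> Null n \<notin> vals (set J)"
        using C' by fastforce
      show ?thesis using reachable.fire [OF J f f4] f5
        by (simp add: set_inst_atoms Un_commute)
    qed (use J in simp)
    then show ?case by (simp add: J_def)
  qed
  ultimately show "reachable (set \<Sigma>) (set I) J" by blast
qed

section \<open>Decoding and well-formedness of inputs\<close>

definition signature :: "fact list \<Rightarrow> tgd list \<Rightarrow> (nat \<times> nat) list" where
  "signature I \<Sigma> = map (\<lambda>a. (rel a, length (args a))) I @
     map (\<lambda>a. (rel a, length (args a))) (concat (map (\<lambda>\<xi>. body \<xi> @ head \<xi>) \<Sigma>))"

definition schema_check :: "fact list \<Rightarrow> tgd list \<Rightarrow> bool" where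
  "schema_check I \<Sigma> \<longleftrightarrow> (\<forall>\<xi>\<in>set \<Sigma>. \<not> head \<xi> = []) \<and> (\<forall>p\<in>set (signature I \<Sigma>). \<not> snd p = 0 \<and>
     (\<forall>q\<in>set (signature I \<Sigma>). fst p = fst q \<longrightarrow> snd p = snd q))"

text \<open>If some schema fits the input, then the symbols that occur in it, with their arities,
  already form one. So it suffices to inspect finitely many pairs.\<close>

lemma schema_check_iff:
  "schema_check I \<Sigma> \<longleftrightarrow>
     (\<exists>S. schema S \<and> instance_over S (set I) \<and> (\<forall>\<xi>\<in>set \<Sigma>. tgd_over S \<xi>))"
proof
  have sig: "set (signature I \<Sigma>) = (\<lambda>a. (rel a, length (args a))) ` set I \<union>
      (\<Union>\<xi>\<in>set \<Sigma>. (\<lambda>a. (rel a, length (args a))) ` (set (body \<xi>) \<union> set (head \<xi>)))"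
    by (auto simp: signature_def)
  {
    assume chk: "schema_check I \<Sigma>"
    define S where "S = map_of (signature I \<Sigma>)"
    have S: "S r = Some k" if rk: "(r, k) \<in> set (signature I \<Sigma>)" for r k
    proof -
      obtain k' where k': "S r = Some k'"
        using weak_map_of_SomeI [OF rk] unfolding S_def by blast
      then have "(r, k') \<in> set (signature I \<Sigma>)" by (auto simp: S_def dest: map_of_SomeD)
      then have "k' = k" using chk rk unfolding schema_check_def by fastforce
      then show ?thesis using k' by simp
    qed
    have "schema S"
      unfolding schema_def
    proof
      show "finite (dom S)" by (simp add: S_def finite_dom_map_of)
      show "\<forall>k\<in>ran S. 0 < k"
      proof
        fix k assume "k \<in> ran S"
        then obtain r where "(r, k) \<in> set (signature I \<Sigma>)"
          by (auto simp: S_def ran_def dest: map_of_SomeD)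
        then show "0 < k" using chk unfolding schema_check_def by fastforce
      qed
    qed
    moreover have "atom_over S a" if "a \<in> set I" for a
      using that unfolding atom_over_def by (intro S) (auto simp: sig)
    moreover have "atom_over S a" if "a \<in> set (body \<xi>) \<union> set (head \<xi>)" "\<xi> \<in> set \<Sigma>" for a \<xi>
      using that unfolding atom_over_def by (intro S) (auto simp: sig)
    ultimately show "\<exists>S. schema S \<and> instance_over S (set I) \<and> (\<forall>\<xi>\<in>set \<Sigma>. tgd_over S \<xi>)"
      using chk by (intro exI [of _ S]) (auto simp: instance_over_def tgd_over_def schema_check_def)
  next
    assume "\<exists>S. schema S \<and> instance_over S (set I) \<and> (\<forall>\<xi>\<in>set \<Sigma>. tgd_over S \<xi>)"
    then obtain S where S: "schema S" "instance_over S (set I)" "\<forall>\<xi>\<in>set \<Sigma>. tgd_over S \<xi>"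
      by blast
    have *: "S (fst p) = Some (snd p)" if "p \<in> set (signature I \<Sigma>)" for p
      using that S(2,3) unfolding sig by (auto simp: instance_over_def tgd_over_def atom_over_def)
    have "0 < snd p" if "p \<in> set (signature I \<Sigma>)" for p
      using *[OF that] S(1) by (auto simp: schema_def ran_def)
    moreover have "snd p = snd q"
      if "p \<in> set (signature I \<Sigma>)" "q \<in> set (signature I \<Sigma>)" "fst p = fst q" for p q
      using *[OF that(1)] *[OF that(2)] that(3) by simp
    moreover have "\<forall>\<xi>\<in>set \<Sigma>. \<not> head \<xi> = []"
      using S(3) by (simp add: tgd_over_def)
    ultimately show "schema_check I \<Sigma>"
      unfolding schema_check_def by blast
  }
qed

definition input_facts :: "nat \<Rightarrow> fact list" where
  "input_facts x = map dec (bits (fst (dec x :: nat \<times> nat)))"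

definition input_tgds :: "nat \<Rightarrow> tgd list" where
  "input_tgds x = map dec (bits (snd (dec x :: nat \<times> nat)))"

lemma set_encode_enc_dec: "set_encode (enc ` set (map dec (bits n))) = n"
  by (simp add: set_bits image_image)

text \<open>As atoms and tgds have bijective codes and every number is the code of a finite set,
  every number is the code of an input; only the schema condition can exclude it as
  malformed.\<close>

lemma input_encode_input: "input_encode (set (input_facts x), set (input_tgds x)) = x"
proof -
  have "input_encode (set (input_facts x), set (input_tgds x)) =
      enc (set_encode (enc ` set (input_facts x)), set_encode (enc ` set (input_tgds x)))"
    by (simp add: input_encode_def enc_tgd_def enc_atom_def enc_val_def)
  also have "\<dots> = enc (dec x :: nat \<times> nat)"
    unfolding input_facts_def input_tgds_def set_encode_enc_dec by simp
  finally show ?thesis by simp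
qed

lemma CT_core_membership_iff:
  "x \<in> CT_core_membership \<longleftrightarrow> schema_check (input_facts x) (input_tgds x) \<and>
     core_chase_terminates (set (input_tgds x)) (set (input_facts x))"
proof
  assume "x \<in> CT_core_membership"
  then obtain S I \<Sigma> where x: "x = input_encode (I, \<Sigma>)" "schema S" "instance_over S I" "\<Sigma> \<in> CT_core S I"
    by (auto simp: CT_core_membership_def)
  have "(set (input_facts x), set (input_tgds x)) = (I, \<Sigma>)"
    using x input_encode_input [of x]
    by (intro inj_onD [OF inj_on_input_encode]) (auto simp: instance_over_def CT_core_def)
  then show "schema_check (input_facts x) (input_tgds x) \<and>
      core_chase_terminates (set (input_tgds x)) (set (input_facts x))"
    using x by (auto simp: schema_check_iff CT_core_def)
next
  assume "schema_check (input_facts x) (input_tgds x) \<and>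
      core_chase_terminates (set (input_tgds x)) (set (input_facts x))"
  then show "x \<in> CT_core_membership"
    unfolding schema_check_iff CT_core_membership_def CT_core_def
    using input_encode_input [of x, symmetric] by blast
qed

theorem recursively_enumerable_CT_core_membership:
  "recursively_enumerable CT_core_membership"
proof -
  \<comment> \<open>The certificate consists of the choices of a run, the facts of \<open>M\<close>,
    and the images of the nulls under the homomorphisms from the input to \<open>M\<close> and from
    \<open>M\<close> to the result of the run.\<close>
  define Q :: "nat \<times> (tgd \<times> val list) list \<times> fact list \<times> val list \<times> val list \<Rightarrow> bool" where
    "Q p \<longleftrightarrow> schema_check (input_facts (fst p)) (input_tgds (fst p)) \<and>
       model_check (input_tgds (fst p)) (fst (snd (snd p))) \<and>
       hom_check (fst (snd (snd (snd p)))) (input_facts (fst p)) (fst (snd (snd p))) \<and>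
       hom_check (snd (snd (snd (snd p)))) (fst (snd (snd p)))
         (foldl (fire_step (input_tgds (fst p))) (input_facts (fst p)) (fst (snd p)))" for p
  have "CT_core_membership = {x. \<exists>c. Q (x, c)}"
  proof (rule set_eqI)
    fix x
    have "(\<exists>c. Q (x, c)) \<longleftrightarrow> schema_check (input_facts x) (input_tgds x) \<and>
        (\<exists>cs M. model_check (input_tgds x) M \<and> (\<exists>ps. hom_check ps (input_facts x) M) \<and>
          (\<exists>qs. hom_check qs M (foldl (fire_step (input_tgds x)) (input_facts x) cs)))"
      by (auto simp: Q_def)
    also have "\<dots> \<longleftrightarrow> schema_check (input_facts x) (input_tgds x) \<and>
        (\<exists>J M. reachable (set (input_tgds x)) (set (input_facts x)) J \<and>
          active_triggers (set (input_tgds x)) (set M) = {} \<and> maps_to (set (input_facts x)) (set M) \<and>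
          maps_to (set M) J)"
      unfolding model_check_iff hom_check_iff reachable_iff by blast
    also have "\<dots> \<longleftrightarrow> x \<in> CT_core_membership"
      unfolding CT_core_membership_iff
        core_chase_terminates_iff_reachable [OF finite_set finite_set]
      by (metis finite_list finite_set)
    finally show "x \<in> CT_core_membership \<longleftrightarrow> x \<in> {x. \<exists>c. Q (x, c)}" by simp
  qed
  moreover have "decidable Q"
    unfolding Q_def schema_check_def signature_def model_check_def hom_check_def fire_step_def
      input_facts_def input_tgds_def
    by (intro computable_intros)
  ultimately show ?thesis
    using recursively_enumerable_if_decidable [of Q] by (simp only:)
qed

section \<open>Hardness\<close>

instance recf :: countable by countable_datatype

text \<open>\<open>RVal f k\<close> is the graph of the \<open>k\<close>-ary function denoted by \<open>f\<close>, and \<open>RBelow (Mu f) k\<close>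
  holds of \<open>xs @ [n]\<close> if \<open>f\<close> is positive on \<open>i # xs\<close> for all \<open>i < n\<close>.\<close>

datatype rsym = RNum | RSuc | RDom | RIn | RVal recf nat | RBelow recf nat

instance rsym :: countable by countable_datatype

fun arity :: "rsym \<Rightarrow> nat" where
  "arity RNum = 1"
| "arity RSuc = 2"
| "arity RDom = 1"
| "arity RIn = 1"
| "arity (RVal f k) = Suc k"
| "arity (RBelow f k) = Suc k"

abbreviation at :: "rsym \<Rightarrow> 'a list \<Rightarrow> 'a atom" where
  "at s ts \<equiv> Atom (to_nat s) ts"

text \<open>Terms carry no arity, so one term may be called with argument lists of several lengths.
  The pairs of terms and lengths to which a call can lead are finitely many, which keeps the set of
  relation symbols finite.\<close>

fun subs :: "recf \<Rightarrow> nat \<Rightarrow> (recf \<times> nat) list" where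
  "subs (Comp f gs) k = (Comp f gs, k) # subs f (length gs) @ concat (map (\<lambda>g. subs g k) gs)"
| "subs (PrimRec f g) (Suc k) = (PrimRec f g, Suc k) # subs f k @ subs g (Suc (Suc k))"
| "subs (Mu f) k = (Mu f, k) # subs f (Suc k)"
| "subs f k = [(f, k)]"

lemma subs_self: "(f, k) \<in> set (subs f k)"
  by (cases "(f, k)" rule: subs.cases) auto

lemma subs_trans: "(g, j) \<in> set (subs f k) \<Longrightarrow> set (subs g j) \<subseteq> set (subs f k)"
proof (induction f k rule: subs.induct)
  case (1 f gs k)
  then show ?case by fastforce
next
  case (2 f g k)
  then show ?case by fastforce
next
  case (3 f k)
  then show ?case by fastforce
qed auto

type_synonym literal = "rsym \<times> trm list"
type_synonym rule = "literal list \<times> literal"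

definition vs :: "nat \<Rightarrow> trm list" where
  "vs k = map Var [0..<k]"

text \<open>Guards for rules such as that of \<open>Zero\<close>, whose argument variables would
  otherwise occur only in the head and become existential.\<close>

definition nums :: "nat \<Rightarrow> literal list" where
  "nums k = map (\<lambda>i. (RNum, [Var i])) [0..<k]"

text \<open>The rules of \<open>computes\<close> become Horn clauses, in which the variables below k
  hold the arguments (for \<open>PrimRec\<close> the parameters) and those from k on hold further
  values. The bounded universal premise of \<open>Mu\<close> has no such form and is replaced by a
  recursion on the bound, where a value is recognised as positive by having a predecessor.\<close>

fun eval_rules :: "recf \<Rightarrow> nat \<Rightarrow> rule list" where
  "eval_rules Zero k = [(nums k, (RVal Zero k, vs k @ [Cst 0]))]"
| "eval_rules Succ k =
     (if k = 1 then [([(RSuc, [Var 0, Var 1])], (RVal Succ 1, [Var 0, Var 1]))] else [])"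
| "eval_rules (Proj i) k =
     (if i < k then [(nums k, (RVal (Proj i) k, vs k @ [Var i]))] else [])"
| "eval_rules (Comp f gs) k =
     [(nums k @ map (\<lambda>j. (RVal (gs ! j) k, vs k @ [Var (k + j)])) [0..<length gs] @
       [(RVal f (length gs), map (\<lambda>j. Var (k + j)) [0..<length gs] @ [Var (k + length gs)])],
       (RVal (Comp f gs) k, vs k @ [Var (k + length gs)]))]"
| "eval_rules (PrimRec f g) 0 = []"
| "eval_rules (PrimRec f g) (Suc k) =
     [([(RVal f k, vs k @ [Var k])], (RVal (PrimRec f g) (Suc k), (Cst 0 # vs k) @ [Var k])),
      ([(RVal (PrimRec f g) (Suc k), (Var k # vs k) @ [Var (k + 1)]), (RSuc, [Var k, Var (k + 2)]),
        (RVal g (Suc (Suc k)), (Var k # Var (k + 1) # vs k) @ [Var (k + 3)])],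
       (RVal (PrimRec f g) (Suc k), (Var (k + 2) # vs k) @ [Var (k + 3)]))]"
| "eval_rules (Mu f) k =
     [(nums k, (RBelow (Mu f) k, vs k @ [Cst 0])),
      ([(RBelow (Mu f) k, vs k @ [Var k]), (RVal f (Suc k), (Var k # vs k) @ [Var (k + 1)]),
        (RSuc, [Var (k + 2), Var (k + 1)]), (RSuc, [Var k, Var (k + 3)])],
       (RBelow (Mu f) k, vs k @ [Var (k + 3)])),
      ([(RBelow (Mu f) k, vs k @ [Var k]), (RVal f (Suc k), (Var k # vs k) @ [Cst 0])],
       (RVal (Mu f) k, vs k @ [Var k]))]"

definition syms :: "recf \<Rightarrow> rsym list" where
  "syms f = [RNum, RSuc, RDom, RIn] @
     concat (map (\<lambda>(g, k). [RVal g k, RBelow g k]) (subs f 1))"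

text \<open>Once a value of \<open>f\<close> at the input has been found, all facts over the constants of the
  instance are derived, and the core of the result consists of these facts.\<close>

definition collapse_rule :: "recf \<Rightarrow> rsym \<Rightarrow> rule" where
  "collapse_rule f s =
     ([(RIn, [Var 0]), (RVal f 1, [Var 0, Var 1])] @ map (\<lambda>i. (RDom, [Var (2 + i)])) [0..<arity s],
      (s, map (\<lambda>i. Var (2 + i)) [0..<arity s]))"

definition rules :: "recf \<Rightarrow> rule list" where
  "rules f = concat (map (\<lambda>(g, k). eval_rules g k) (subs f 1)) @ map (collapse_rule f) (syms f)"

definition tgd_of_rule :: "rule \<Rightarrow> tgd" where
  "tgd_of_rule r = Tgd (map (\<lambda>l. at (fst l) (snd l)) (fst r)) [at (fst (snd r)) (snd (snd r))]"

definition suc_tgd :: tgd where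
  "suc_tgd = Tgd [at RNum [Var 0]] [at RSuc [Var 0, Var 1], at RNum [Var 1]]"

definition program :: "recf \<Rightarrow> tgd set" where
  "program f = insert suc_tgd (tgd_of_rule ` set (rules f))"

lemma set_vs [simp]: "set (vs k) = Var ` {..<k}"
  by (auto simp: vs_def)

lemma length_vs [simp]: "length (vs k) = k"
  by (simp add: vs_def)

lemma set_nums [simp]: "set (nums k) = (\<lambda>i. (RNum, [Var i])) ` {..<k}"
  by (auto simp: nums_def)

lemma subs_Comp:
  assumes "(Comp f gs, k) \<in> set (subs h j)"
  shows "(f, length gs) \<in> set (subs h j)" "g \<in> set gs \<Longrightarrow> (g, k) \<in> set (subs h j)"
  using subs_trans [OF assms] subs_self [of f "length gs"] subs_self [of g k] by auto

lemma subs_PrimRec: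
  assumes "(PrimRec f g, Suc k) \<in> set (subs h j)"
  shows "(f, k) \<in> set (subs h j)" "(g, Suc (Suc k)) \<in> set (subs h j)"
  using subs_trans [OF assms] subs_self [of f k] subs_self [of g "Suc (Suc k)"] by auto

lemma subs_Mu:
  assumes "(Mu f, k) \<in> set (subs h j)"
  shows "(f, Suc k) \<in> set (subs h j)"
  using subs_trans [OF assms] subs_self [of f "Suc k"] by auto

lemma syms_simps [simp]:
  "RNum \<in> set (syms f)" "RSuc \<in> set (syms f)" "RDom \<in> set (syms f)" "RIn \<in> set (syms f)"
  "RVal g k \<in> set (syms f) \<longleftrightarrow> (g, k) \<in> set (subs f 1)"
  by (auto simp: syms_def)

lemma RBelow_in_syms: "RBelow g k \<in> set (syms f) \<longleftrightarrow> (g, k) \<in> set (subs f 1)"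
  by (auto simp: syms_def)

text \<open>With 0 as the only constant in the rules, the program is the same for all inputs, and an
  interpretation of the numbers only has to respect 0.\<close>

definition literal_ok :: "recf \<Rightarrow> literal \<Rightarrow> bool" where
  "literal_ok f l \<longleftrightarrow> fst l \<in> set (syms f) \<and> length (snd l) = arity (fst l) \<and>
     (\<forall>c. Cst c \<in> set (snd l) \<longrightarrow> c = 0)"

text \<open>The last clause is the range restriction of Datalog: the corresponding tgd has no
  existential variables.\<close>

definition rule_ok :: "recf \<Rightarrow> rule \<Rightarrow> bool" where
  "rule_ok f r \<longleftrightarrow> (\<forall>l\<in>set (fst r). literal_ok f l) \<and> literal_ok f (snd r) \<and>
     (\<forall>x. Var x \<in> set (snd (snd r)) \<longrightarrow> (\<exists>l\<in>set (fst r). Var x \<in> set (snd l)))"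

lemma rule_ok_eval:
  assumes "(g, k) \<in> set (subs f 1)" "r \<in> set (eval_rules g k)"
  shows "rule_ok f r"
  using assms
proof (cases "(g, k)" rule: eval_rules.cases)
  case (4 h gs j)
  then show ?thesis using assms subs_Comp [of h gs k f 1]
    by (auto simp: rule_ok_def literal_ok_def ball_Un bex_Un)
next
  case (6 h h' j)
  then show ?thesis using assms subs_PrimRec [of h h' j f 1]
    by (auto simp: rule_ok_def literal_ok_def)
next
  case (7 h j)
  then show ?thesis using assms subs_Mu [of h k f 1]
    by (auto simp: rule_ok_def literal_ok_def RBelow_in_syms)
qed (auto simp: rule_ok_def literal_ok_def split: if_splits)

lemma rule_ok_rules:
  assumes "r \<in> set (rules f)"
  shows "rule_ok f r"
proof -
  consider g k where "(g, k) \<in> set (subs f 1)" "r \<in> set (eval_rules g k)"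
    | s where "s \<in> set (syms f)" "r = collapse_rule f s"
    using assms by (auto simp: rules_def)
  then show ?thesis
  proof cases
    case 1
    then show ?thesis by (rule rule_ok_eval)
  next
    case 2
    then show ?thesis using subs_self [of f 1]
      by (auto simp: rule_ok_def literal_ok_def collapse_rule_def)
  qed
qed

section \<open>Relations on numbers as models of the program\<close>

fun eval_trm :: "(nat \<Rightarrow> nat) \<Rightarrow> trm \<Rightarrow> nat" where
  "eval_trm \<sigma> (Var x) = \<sigma> x"
| "eval_trm \<sigma> (Cst c) = c"

definition holds :: "(rsym \<Rightarrow> nat list \<Rightarrow> bool) \<Rightarrow> (nat \<Rightarrow> nat) \<Rightarrow> literal \<Rightarrow> bool" where
  "holds T \<sigma> l \<longleftrightarrow> T (fst l) (map (eval_trm \<sigma>) (snd l))"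

text \<open>\<open>T\<close> stands for three things below: truth in the standard model, the full
  relations on the numbers up to the input, and an instance read through an assignment of values to
  numbers.\<close>

definition closed_under :: "(rsym \<Rightarrow> nat list \<Rightarrow> bool) \<Rightarrow> rule \<Rightarrow> bool" where
  "closed_under T r \<longleftrightarrow> (\<forall>\<sigma>. (\<forall>l\<in>set (fst r). holds T \<sigma> l) \<longrightarrow> holds T \<sigma> (snd r))"

definition fact_structure :: "(rsym \<Rightarrow> nat list \<Rightarrow> bool) \<Rightarrow> fact set" where
  "fact_structure T = {at s (map Const ns) | s ns. T s ns}"

lemma at_in_structure [simp]: "at s (map Const ns) \<in> fact_structure T \<longleftrightarrow> T s ns"
  by (auto simp: fact_structure_def inj_map_eq_map [of Const] inj_def)

lemma body_tgd_of_rule [simp]: "body (tgd_of_rule r) = map (\<lambda>l. at (fst l) (snd l)) (fst r)"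
  and head_tgd_of_rule [simp]: "head (tgd_of_rule r) = [at (fst (snd r)) (snd (snd r))]"
  by (simp_all add: tgd_of_rule_def)

lemma vars_literals:
  "x \<in> vars (map (\<lambda>l. at (fst l) (snd l)) ls) \<longleftrightarrow> (\<exists>l\<in>set ls. Var x \<in> set (snd l))"
  by (auto simp: vars_def)

lemma evars_tgd_of_rule:
  assumes "rule_ok f r"
  shows "evars (tgd_of_rule r) = {}"
proof -
  have "vars (head (tgd_of_rule r)) = {x. Var x \<in> set (snd (snd r))}"
    by (auto simp: vars_def)
  then show ?thesis using assms by (auto simp: evars_def vars_literals rule_ok_def)
qed

lemma uvars_tgd_of_rule:
  "uvars (tgd_of_rule r) = {x. \<exists>l\<in>set (fst r). Var x \<in> set (snd l)}"
  by (simp only: uvars_def body_tgd_of_rule vars_literals set_eq_iff mem_Collect_eq simp_thms)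

lemma structure_model:
  assumes ok: "\<And>r. r \<in> set (rules f) \<Longrightarrow> closed_under T r"
    and suc: "\<And>n. T RNum [n] \<Longrightarrow> \<exists>m. T RSuc [n, m] \<and> T RNum [m]"
  shows "active_triggers (program f) (fact_structure T) = {}"
proof -
  have "satisfied \<xi> h (fact_structure T)" if tr: "(\<xi>, h) \<in> triggers (program f) (fact_structure T)" for \<xi> h
  proof -
    have dom: "dom h = uvars \<xi>" and bd: "facts_of h (body \<xi>) \<subseteq> fact_structure T"
      using tr by (auto simp: triggers_def)
    consider "\<xi> = suc_tgd" | r where "r \<in> set (rules f)" "\<xi> = tgd_of_rule r"
      using tr by (auto simp: triggers_def program_def)
    then show ?thesis
    proof cases
      case 1
      have "at RNum [the (h 0)] \<in> fact_structure T"
        using bd by (simp add: 1 suc_tgd_def facts_of_def)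
      then obtain n where n: "the (h 0) = Const n" "T RNum [n]"
        by (auto simp: fact_structure_def)
      obtain m where m: "T RSuc [n, m]" "T RNum [m]" using suc [OF n(2)] by blast
      have var: "uvars \<xi> = {0}" "evars \<xi> = {1}"
        by (auto simp: 1 suc_tgd_def uvars_def evars_def vars_def)
      then have "0 \<in> dom h" using dom by simp
      then have "h 0 = Some (Const n)" using n(1) by auto
      moreover have "at RSuc (map Const [n, m]) \<in> fact_structure T" "at RNum (map Const [m]) \<in> fact_structure T"
        using m by (simp_all only: at_in_structure)
      ultimately show ?thesis
        using dom var unfolding satisfied_def
        by (intro exI [of _ "h(1 \<mapsto> Const m)"])
          (auto simp: 1 suc_tgd_def facts_of_def map_le_def)
    next
      case 2
      \<comment> \<open>The value 0 for nulls is a dummy: variables of the body take values in the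
        structure, and these are constants.\<close>
      define \<sigma> where "\<sigma> x = (case the (h x) of Const n \<Rightarrow> n | Null _ \<Rightarrow> 0)" for x
      have lit: "holds T \<sigma> l \<and> (\<forall>x. Var x \<in> set (snd l) \<longrightarrow> the (h x) = Const (\<sigma> x))"
        if "l \<in> set (fst r)" for l
      proof -
        have "at (fst l) (map (val_of h) (snd l)) \<in> fact_structure T"
          using bd that by (auto simp: 2 facts_of_def image_subset_iff)
        then obtain ns where ns: "map (val_of h) (snd l) = map Const ns" "T (fst l) ns"
          by (auto simp: fact_structure_def)
        have "val_of h t = Const (eval_trm \<sigma> t)" if t: "t \<in> set (snd l)" for t
        proof (cases t)
          case (Var x)
          have "val_of h t \<in> set (map Const ns)" using t unfolding ns(1) [symmetric] by simp
          then show ?thesis by (auto simp: \<sigma>_def Var)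
        qed simp
        then have "map (val_of h) (snd l) = map Const (map (eval_trm \<sigma>) (snd l))"
          and "\<forall>x. Var x \<in> set (snd l) \<longrightarrow> the (h x) = Const (\<sigma> x)"
          by fastforce+
        then show ?thesis using ns
          by (simp add: holds_def inj_map_eq_map [of Const] inj_def del: map_map)
      qed
      have "holds T \<sigma> (snd r)"
        using ok [OF 2(1)] lit by (simp add: closed_under_def)
      moreover have "map (val_of h) (snd (snd r)) = map Const (map (eval_trm \<sigma>) (snd (snd r)))"
      proof -
        have "val_of h t = Const (eval_trm \<sigma> t)" if t: "t \<in> set (snd (snd r))" for t
        proof (cases t)
          case (Var x)
          then obtain l where "l \<in> set (fst r)" "Var x \<in> set (snd l)"
            using t rule_ok_rules [OF 2(1)] unfolding rule_ok_def by blast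
          then show ?thesis using lit by (simp add: Var)
        qed simp
        then show ?thesis by simp
      qed
      ultimately have "facts_of h (head \<xi>) \<subseteq> fact_structure T"
        by (simp add: 2 facts_of_def holds_def del: map_map)
      then show ?thesis
        using dom evars_tgd_of_rule [OF rule_ok_rules [OF 2(1)]]
        unfolding satisfied_def by (intro exI [of _ h]) (simp add: 2)
    qed
  qed
  then show ?thesis by (auto simp: active_triggers_eq)
qed

lemma model_suc:
  assumes "active_triggers (program f) M = {}" "at RNum [v] \<in> M"
  shows "\<exists>w. at RSuc [v, w] \<in> M \<and> at RNum [w] \<in> M"
proof -
  have "uvars suc_tgd = {0}" by (auto simp: suc_tgd_def uvars_def vars_def)
  then have "(suc_tgd, [0 \<mapsto> v]) \<in> triggers (program f) M"
    using assms(2) by (simp add: triggers_def program_def suc_tgd_def facts_of_def)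
  then have "satisfied suc_tgd [0 \<mapsto> v] M"
    using assms(1) by (auto simp: active_triggers_eq)
  then show ?thesis
    by (auto simp: satisfied_def suc_tgd_def facts_of_def map_le_def) (metis option.sel)
qed

text \<open>Rules contain no negation or inequality and only the constant 0, so they survive reading
  numbers as values through any \<open>e\<close> that is right at 0. Such an \<open>e\<close> may
  identify numbers and may use nulls.\<close>

lemma model_closed_under:
  assumes M: "active_triggers (program f) M = {}" and r: "r \<in> set (rules f)"
    and e: "e 0 = Const 0"
  shows "closed_under (\<lambda>s ns. at s (map e ns) \<in> M) r"
  unfolding closed_under_def
proof (intro allI impI)
  fix \<sigma> assume bd: "\<forall>l\<in>set (fst r). holds (\<lambda>s ns. at s (map e ns) \<in> M) \<sigma> l"
  note ok = rule_ok_rules [OF r]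
  define \<xi> where "\<xi> = tgd_of_rule r"
  define h where "h = (\<lambda>x. Some (e (\<sigma> x))) |` uvars \<xi>"
  have val: "val_of h t = e (eval_trm \<sigma> t)"
    if "t \<in> set (snd l)" "l \<in> insert (snd r) (set (fst r))" for t l
  proof (cases t)
    case (Var x)
    then have "x \<in> uvars \<xi>"
      using that ok by (auto simp: \<xi>_def uvars_tgd_of_rule rule_ok_def)
    then show ?thesis by (simp add: Var h_def)
  next
    case (Cst c)
    then have "c = 0" using that ok by (auto simp: rule_ok_def literal_ok_def)
    then show ?thesis by (simp add: Cst e)
  qed
  have map_val: "map (val_of h) (snd l) = map e (map (eval_trm \<sigma>) (snd l))"
    if "l \<in> insert (snd r) (set (fst r))" for l
    using val that by simp
  have "facts_of h (body \<xi>) \<subseteq> M"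
  proof
    fix a assume "a \<in> facts_of h (body \<xi>)"
    then obtain l where l: "l \<in> set (fst r)" "a = at (fst l) (map (val_of h) (snd l))"
      by (auto simp: facts_of_def \<xi>_def)
    then show "a \<in> M" using bd map_val [of l] by (simp add: holds_def del: map_map)
  qed
  then have "(\<xi>, h) \<in> triggers (program f) M"
    using r by (auto simp: triggers_def program_def \<xi>_def h_def)
  then have "satisfied \<xi> h M" using M by (auto simp: active_triggers_eq)
  then obtain h' where h': "h \<subseteq>\<^sub>m h'" "dom h' = uvars \<xi>" "facts_of h' (head \<xi>) \<subseteq> M"
    using evars_tgd_of_rule [OF ok] by (auto simp: satisfied_def \<xi>_def)
  have "h' = h"
  proof
    fix x
    show "h' x = h x"
      using h'(1,2) by (cases "x \<in> uvars \<xi>") (force simp: map_le_def h_def)+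
  qed
  then have "at (fst (snd r)) (map (val_of h) (snd (snd r))) \<in> M"
    using h'(3) by (simp add: facts_of_def \<xi>_def)
  then show "holds (\<lambda>s ns. at s (map e ns) \<in> M) \<sigma> (snd r)"
    using map_val [of "snd r"] by (simp add: holds_def del: map_map)
qed

section \<open>The standard model and the full structure\<close>

fun true_fact :: "nat \<Rightarrow> rsym \<Rightarrow> nat list \<Rightarrow> bool" where
  "true_fact x RNum ns \<longleftrightarrow> length ns = 1"
| "true_fact x RSuc ns \<longleftrightarrow> (\<exists>n. ns = [n, Suc n])"
| "true_fact x RDom ns \<longleftrightarrow> (\<exists>n\<le>x. ns = [n])"
| "true_fact x RIn ns \<longleftrightarrow> ns = [x]"
| "true_fact x (RVal f k) ns \<longleftrightarrow>
     ns \<noteq> [] \<and> length (butlast ns) = k \<and> computes f (butlast ns) (last ns)"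
| "true_fact x (RBelow f k) ns \<longleftrightarrow>
     ns \<noteq> [] \<and> length (butlast ns) = k \<and>
     (\<exists>g. f = Mu g \<and> (\<forall>i<last ns. \<exists>v. computes g (i # butlast ns) (Suc v)))"

lemma true_fact_snoc:
  "true_fact x (RVal f k) (ns @ [n]) \<longleftrightarrow> length ns = k \<and> computes f ns n"
  "true_fact x (RBelow (Mu f) k) (ns @ [n]) \<longleftrightarrow>
     length ns = k \<and> (\<forall>i<n. \<exists>v. computes f (i # ns) (Suc v))"
  by simp_all

text \<open>Read through \<open>true_fact\<close>, the evaluation rules are the introduction rules
  of \<open>computes\<close>; those for \<open>RBelow\<close> start the bound at 0 and raise it by
  one.\<close>

lemma true_fact_closed_under_eval:
  assumes "r \<in> set (eval_rules g k)"
  shows "closed_under (true_fact x) r"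
proof (cases "(g, k)" rule: eval_rules.cases)
  case (4 f gs j)
  have "holds (true_fact x) \<sigma> (snd r)" if bd: "\<forall>l\<in>set (fst r). holds (true_fact x) \<sigma> l" for \<sigma>
  proof -
    let ?xs = "map \<sigma> [0..<k]" and ?ys = "map (\<lambda>j. \<sigma> (k + j)) [0..<length gs]"
    have "computes (gs ! i) ?xs (\<sigma> (k + i))" if "i < length gs" for i
      using bd assms that 4 by (simp add: holds_def ball_Un vs_def true_fact_snoc comp_def del: true_fact.simps)
    then have "list_all2 (\<lambda>g y. computes g ?xs y) gs ?ys"
      by (simp add: list_all2_conv_all_nth)
    moreover have "computes f ?ys (\<sigma> (k + length gs))"
      using bd assms 4 by (simp add: holds_def ball_Un vs_def true_fact_snoc comp_def del: true_fact.simps)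
    ultimately show ?thesis
      using assms 4 by (auto simp: holds_def vs_def true_fact_snoc comp_def simp del: true_fact.simps
          intro: computes.comp)
  qed
  then show ?thesis by (simp add: closed_under_def)
next
  case (6 f h j)
  then show ?thesis using assms
    by (auto simp: closed_under_def holds_def vs_def comp_def
        intro: computes.primrec_0 computes.primrec_Suc)
next
  case (7 f j)
  then show ?thesis using assms
    by (auto simp: closed_under_def holds_def vs_def comp_def less_Suc_eq intro: computes.mu) blast
qed (use assms in \<open>auto simp: closed_under_def holds_def vs_def comp_def nth_append
      intro: computes.zero computes.succ computes_Proj split: if_splits\<close>)

text \<open>Divergence serves the collapse rules: it makes their bodies false.\<close>

lemma true_fact_closed_under:
  assumes "r \<in> set (rules f)" "\<nexists>y. computes f [x] y"
  shows "closed_under (true_fact x) r"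
proof -
  consider g k where "r \<in> set (eval_rules g k)" | s where "r = collapse_rule f s"
    using assms(1) by (auto simp: rules_def)
  then show ?thesis
  proof cases
    case 1
    then show ?thesis by (rule true_fact_closed_under_eval)
  next
    case 2
    then show ?thesis using assms(2) by (auto simp: closed_under_def holds_def collapse_rule_def)
  qed
qed

text \<open>Here \<open>RSuc\<close> relates each number up to x to itself, so that the successor
  rule is satisfied without any further value.\<close>

definition full_fact :: "recf \<Rightarrow> nat \<Rightarrow> rsym \<Rightarrow> nat list \<Rightarrow> bool" where
  "full_fact f x s ns \<longleftrightarrow> s \<in> set (syms f) \<and> length ns = arity s \<and> set ns \<subseteq> {..x}"

lemma full_fact_closed_under:
  assumes "r \<in> set (rules f)"
  shows "closed_under (full_fact f x) r"
  unfolding closed_under_def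
proof (intro allI impI)
  fix \<sigma> assume bd: "\<forall>l\<in>set (fst r). holds (full_fact f x) \<sigma> l"
  note ok = rule_ok_rules [OF assms]
  have "eval_trm \<sigma> t \<le> x" if t: "t \<in> set (snd (snd r))" for t
  proof (cases t)
    case (Var z)
    then obtain l where "l \<in> set (fst r)" "t \<in> set (snd l)"
      using t ok unfolding rule_ok_def by blast
    then show ?thesis using bd by (auto simp: holds_def full_fact_def)
  next
    case (Cst c)
    then show ?thesis using t ok by (auto simp: rule_ok_def literal_ok_def)
  qed
  then show "holds (full_fact f x) \<sigma> (snd r)"
    using ok by (auto simp: holds_def full_fact_def rule_ok_def literal_ok_def)
qed

lemma finite_full: "finite (fact_structure (full_fact f x))"
proof -
  have "fact_structure (full_fact f x) \<subseteq> (\<Union>s\<in>set (syms f).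
      (\<lambda>ns. at s (map Const ns)) ` {ns. set ns \<subseteq> {..x} \<and> length ns = arity s})"
    by (auto simp: fact_structure_def full_fact_def)
  moreover have "finite \<dots>" by (intro finite_UN_I finite_imageI finite_lists_length_eq) auto
  ultimately show ?thesis by (rule finite_subset)
qed

section \<open>Derivations that follow a computation\<close>

lemma map_eval_vs:
  "length ns = k \<Longrightarrow> map (eval_trm (\<lambda>i. (ns @ zs) ! i)) (vs k) = ns"
  by (auto simp: vs_def nth_append intro!: nth_equalityI)

lemma closed_underD:
  assumes "closed_under T r" "\<And>l. l \<in> set (fst r) \<Longrightarrow> holds T \<sigma> l"
  shows "holds T \<sigma> (snd r)"
  using assms by (simp add: closed_under_def)

text \<open>The completeness half: along an induction on \<open>computes\<close>, each evaluation
  step uses the corresponding rules. \<open>T\<close> may contain false facts as well; what matters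
  is that it contains all numbers with their successors and is closed.\<close>

lemma computes_derivable:
  assumes T: "\<And>r. r \<in> set (rules f) \<Longrightarrow> closed_under T r"
    and num: "\<And>n. T RNum [n]" and suc: "\<And>n. T RSuc [n, Suc n]"
  shows "computes g ns y \<Longrightarrow> (g, length ns) \<in> set (subs f 1) \<Longrightarrow> T (RVal g (length ns)) (ns @ [y])"
proof (induction rule: computes.induct)
  have cl: "closed_under T r" if "r \<in> set (eval_rules g k)" "(g, k) \<in> set (subs f 1)" for r g k
    using that by (intro T) (auto simp: rules_def)
  have nums: "holds T \<sigma> l" if "l \<in> set (nums k)" for \<sigma> l k
    using that num by (auto simp: holds_def)
  {
    case (zero ns)
    \<comment> \<open>The empty tail gives the assignment the form expected by
      \<open>map_eval_vs\<close>; this is also why \<open>append_Nil2\<close> is removed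
      below.\<close>
    have "holds T (\<lambda>i. (ns @ []) ! i) (RVal Zero (length ns), vs (length ns) @ [Cst 0])"
      using closed_underD [OF cl [OF _ zero]] nums by simp
    then show ?case by (simp add: holds_def map_eval_vs del: append_Nil2)
  next
    case (succ x)
    have "holds T (\<lambda>i. [x, Suc x] ! i) (RVal Succ 1, [Var 0, Var 1])"
      using closed_underD [OF cl [of "([(RSuc, [Var 0, Var 1])], _)" Succ 1], where \<sigma> = "\<lambda>i. [x, Suc x] ! i"]
        succ suc by (simp add: holds_def)
    then show ?case by (simp add: holds_def)
  next
    case (proj i ns)
    have "holds T (\<lambda>i. (ns @ []) ! i) (RVal (Proj i) (length ns), vs (length ns) @ [Var i])"
      using closed_underD [OF cl [OF _ proj(2)]] proj(1) nums by simp
    then show ?case by (simp add: holds_def map_eval_vs del: append_Nil2) simp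
  next
    case (comp ns gs ys g z)
    let ?\<sigma> = "\<lambda>i. (ns @ ys @ [z]) ! i"
    have len: "length gs = length ys" using comp.IH(1) by (rule list_all2_lengthD)
    have sub: "(g, length gs) \<in> set (subs f 1)" "\<And>i. i < length gs \<Longrightarrow> (gs ! i, length ns) \<in> set (subs f 1)"
      using subs_Comp [OF comp.prems] by auto
    define r where "r = (nums (length ns) @
        map (\<lambda>j. (RVal (gs ! j) (length ns), vs (length ns) @ [Var (length ns + j)])) [0..<length gs] @
        [(RVal g (length gs), map (\<lambda>j. Var (length ns + j)) [0..<length gs] @ [Var (length ns + length gs)])],
        (RVal (Comp g gs) (length ns), vs (length ns) @ [Var (length ns + length gs)]))"
    have "holds T ?\<sigma> (snd r)"
    proof (rule closed_underD [OF cl [OF _ comp.prems]])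
      show "r \<in> set (eval_rules (Comp g gs) (length ns))" by (simp add: r_def)
      fix l assume "l \<in> set (fst r)"
      then consider "l \<in> set (nums (length ns))"
        | i where "i < length gs" "l = (RVal (gs ! i) (length ns), vs (length ns) @ [Var (length ns + i)])"
        | "l = (RVal g (length gs), map (\<lambda>j. Var (length ns + j)) [0..<length gs] @ [Var (length ns + length gs)])"
        by (auto simp: r_def)
      then show "holds T ?\<sigma> l"
      proof cases
        case 1
        then show ?thesis by (rule nums)
      next
        case 2
        then have "T (RVal (gs ! i) (length ns)) (ns @ [ys ! i])"
          using comp.IH(1) sub(2) by (simp add: list_all2_conv_all_nth)
        then show ?thesis using 2 len by (simp add: holds_def map_eval_vs nth_append_left)
      next
        case 3
        have "map (\<lambda>j. (ys @ [z]) ! j) [0..<length ys] = ys"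
          by (auto simp: nth_append intro!: nth_equalityI)
        moreover have "T (RVal g (length gs)) (ys @ [z])"
          using comp.IH(2) sub(1) len by simp
        ultimately show ?thesis using 3 len by (simp add: holds_def comp_def)
      qed
    qed
    then have "holds T ?\<sigma> (RVal (Comp g gs) (length ns), vs (length ns) @ [Var (length ns + length gs)])"
      by (simp add: r_def)
    then show ?case by (simp add: holds_def map_eval_vs len)
  next
    case (primrec_0 g ns y h)
    let ?k = "length ns" and ?\<sigma> = "\<lambda>i. (ns @ [y]) ! i"
    have sub: "(PrimRec g h, Suc ?k) \<in> set (subs f 1)" using primrec_0.prems by simp
    have "T (RVal g ?k) (ns @ [y])"
      using primrec_0.IH subs_PrimRec [OF sub] by simp
    then have "holds T ?\<sigma> (RVal (PrimRec g h) (Suc ?k), (Cst 0 # vs ?k) @ [Var ?k])"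
      using closed_underD [OF cl [OF _ sub], of "([(RVal g ?k, vs ?k @ [Var ?k])], _)" ?\<sigma>]
      by (simp add: holds_def map_eval_vs)
    then show ?case by (simp add: holds_def map_eval_vs)
  next
    case (primrec_Suc g h n ns y z)
    \<comment> \<open>The entries after \<open>ns\<close> are the values of the variables k to k + 3
      in the second rule for \<open>PrimRec\<close>.\<close>
    let ?k = "length ns" and ?\<sigma> = "\<lambda>i. (ns @ [n, y, Suc n, z]) ! i"
    have sub: "(PrimRec g h, Suc ?k) \<in> set (subs f 1)" using primrec_Suc.prems by simp
    have "T (RVal (PrimRec g h) (Suc ?k)) (n # ns @ [y])" "T (RVal h (Suc (Suc ?k))) (n # y # ns @ [z])"
      using primrec_Suc.IH subs_PrimRec [OF sub] sub by simp_all
    note facts = this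
    have \<sigma>: "?\<sigma> ?k = n" "?\<sigma> (Suc ?k) = y" "?\<sigma> (Suc (Suc ?k)) = Suc n" "?\<sigma> (?k + 3) = z"
      by (simp_all add: nth_append)
    define r where "r = ([(RVal (PrimRec g h) (Suc ?k), (Var ?k # vs ?k) @ [Var (?k + 1)]),
        (RSuc, [Var ?k, Var (?k + 2)]),
        (RVal h (Suc (Suc ?k)), (Var ?k # Var (?k + 1) # vs ?k) @ [Var (?k + 3)])],
       (RVal (PrimRec g h) (Suc ?k), (Var (?k + 2) # vs ?k) @ [Var (?k + 3)]))"
    have "holds T ?\<sigma> (snd r)"
    proof (rule closed_underD [OF cl [OF _ sub]])
      show "r \<in> set (eval_rules (PrimRec g h) (Suc ?k))" by (simp add: r_def)
      show "holds T ?\<sigma> l" if "l \<in> set (fst r)" for l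
        using that facts suc by (auto simp: r_def holds_def map_eval_vs \<sigma>)
    qed
    then show ?case by (simp add: r_def holds_def map_eval_vs \<sigma>)
  next
    case (mu g n ns)
    let ?k = "length ns"
    have sub: "(Mu g, ?k) \<in> set (subs f 1)" using mu.prems .
    \<comment> \<open>The bounded quantifier of \<open>Mu\<close> is unrolled: the bound rises from
      0 to n, and each increment uses the positive value at the current bound.\<close>
    have "T (RBelow (Mu g) ?k) (ns @ [j])" if "j \<le> n" for j
      using that
    proof (induction j)
      case 0
      have "holds T (\<lambda>i. (ns @ []) ! i) (RBelow (Mu g) ?k, vs ?k @ [Cst 0])"
        using closed_underD [OF cl [OF _ sub], of "(nums ?k, _)"] nums by simp
      then show ?case by (simp add: holds_def map_eval_vs del: append_Nil2)
    next
      case (Suc j)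
      then have "j < n" by simp
      then obtain v where "(g, length (j # ns)) \<in> set (subs f 1) \<longrightarrow>
          T (RVal g (length (j # ns))) ((j # ns) @ [Suc v])"
        using mu.IH(2) by blast
      then have v: "T (RVal g (Suc ?k)) (j # ns @ [Suc v])"
        using subs_Mu [OF sub] by simp
      let ?\<sigma> = "\<lambda>i. (ns @ [j, Suc v, v, Suc j]) ! i"
      have \<sigma>: "?\<sigma> ?k = j" "?\<sigma> (Suc ?k) = Suc v" "?\<sigma> (Suc (Suc ?k)) = v" "?\<sigma> (?k + 3) = Suc j"
        by (simp_all add: nth_append)
      have below: "T (RBelow (Mu g) ?k) (ns @ [j])" using Suc by simp
      define r where "r = ([(RBelow (Mu g) ?k, vs ?k @ [Var ?k]),
          (RVal g (Suc ?k), (Var ?k # vs ?k) @ [Var (?k + 1)]),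
          (RSuc, [Var (?k + 2), Var (?k + 1)]), (RSuc, [Var ?k, Var (?k + 3)])],
         (RBelow (Mu g) ?k, vs ?k @ [Var (?k + 3)]))"
      have "holds T ?\<sigma> (snd r)"
      proof (rule closed_underD [OF cl [OF _ sub]])
        show "r \<in> set (eval_rules (Mu g) ?k)" by (simp add: r_def)
        show "holds T ?\<sigma> l" if "l \<in> set (fst r)" for l
          using that v below suc by (auto simp: r_def holds_def map_eval_vs \<sigma>)
      qed
      then show ?case by (simp add: r_def holds_def map_eval_vs \<sigma>)
    qed
    then have facts: "T (RBelow (Mu g) ?k) (ns @ [n])" "T (RVal g (Suc ?k)) (n # ns @ [0])"
      using mu.IH(1) subs_Mu [OF sub] by simp_all
    define r where "r = ([(RBelow (Mu g) ?k, vs ?k @ [Var ?k]),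
        (RVal g (Suc ?k), (Var ?k # vs ?k) @ [Cst 0])], (RVal (Mu g) ?k, vs ?k @ [Var ?k]))"
    have "holds T (\<lambda>i. (ns @ [n]) ! i) (snd r)"
    proof (rule closed_underD [OF cl [OF _ sub]])
      show "r \<in> set (eval_rules (Mu g) ?k)" by (simp add: r_def)
      show "holds T (\<lambda>i. (ns @ [n]) ! i) l" if "l \<in> set (fst r)" for l
        using that facts by (auto simp: r_def holds_def map_eval_vs)
    qed
    then show ?case by (simp add: r_def holds_def map_eval_vs)
  }
qed

lemma full_derivable:
  assumes T: "\<And>r. r \<in> set (rules f) \<Longrightarrow> closed_under T r"
    and num: "\<And>n. T RNum [n]" and suc: "\<And>n. T RSuc [n, Suc n]"
    and dom: "\<And>n. n \<le> x \<Longrightarrow> T RDom [n]" and inp: "T RIn [x]"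
    and comp: "computes f [x] y" and full: "full_fact f x s ns"
  shows "T s ns"
proof -
  have s: "s \<in> set (syms f)" "length ns = arity s" "set ns \<subseteq> {..x}"
    using full by (simp_all add: full_fact_def)
  have "T (RVal f 1) [x, y]"
    using computes_derivable [OF T num suc comp] subs_self [of f 1] by simp
  moreover have "T RDom [ns ! i]" if "i < arity s" for i
    using s that by (intro dom) (metis atMost_iff nth_mem subsetD)
  moreover have "collapse_rule f s \<in> set (rules f)"
    using s by (simp add: rules_def)
  \<comment> \<open>Variables 0 and 1 of the collapse rule stand for the input and the value found,
    the others for the arguments of the fact to be derived.\<close>
  ultimately have "holds T (\<lambda>i. (x # y # ns) ! i) (snd (collapse_rule f s))"
    using inp by (intro closed_underD [OF T]) (auto simp: collapse_rule_def holds_def)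
  moreover have "map (\<lambda>i. ns ! i) [0..<arity s] = ns"
    using s(2) by (metis map_nth)
  ultimately show ?thesis by (simp add: collapse_rule_def holds_def comp_def)
qed

text \<open>Constants carry no arithmetic, so the chain of successors from 0 to x is what makes the
  constant for x mean the number x.\<close>

definition input_list :: "nat \<Rightarrow> fact list" where
  "input_list x =
     at RIn [Const x] #
     map (\<lambda>n. at RNum [Const n]) [0..<Suc x] @
     map (\<lambda>n. at RDom [Const n]) [0..<Suc x] @
     map (\<lambda>n. at RSuc [Const n, Const (Suc n)]) [0..<x]"

lemma distinct_input_list: "distinct (input_list x)"
  by (auto simp: input_list_def distinct_map inj_on_def)

lemma in_input_list:
  "n \<le> x \<Longrightarrow> at RNum [Const n] \<in> set (input_list x)"
  "n \<le> x \<Longrightarrow> at RDom [Const n] \<in> set (input_list x)"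
  "n < x \<Longrightarrow> at RSuc [Const n, Const (Suc n)] \<in> set (input_list x)"
  "at RIn [Const x] \<in> set (input_list x)"
  by (auto simp: input_list_def)

lemma input_list_subset:
  assumes "\<And>n. n \<le> x \<Longrightarrow> T RNum [n]" "\<And>n. n \<le> x \<Longrightarrow> T RDom [n]"
    "\<And>n. n < x \<Longrightarrow> T RSuc [n, Suc n]" "T RIn [x]"
  shows "set (input_list x) \<subseteq> fact_structure T"
proof -
  have "at s [Const n] \<in> fact_structure T \<longleftrightarrow> T s [n]"
    "at s [Const n, Const m] \<in> fact_structure T \<longleftrightarrow> T s [n, m]" for s n m
    using at_in_structure [of s "[n]" T] at_in_structure [of s "[n, m]" T] by simp_all
  then show ?thesis using assms by (auto simp: input_list_def)
qed

theorem program_terminates_iff: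
  "core_chase_terminates (program f) (set (input_list x)) \<longleftrightarrow> (\<exists>y. computes f [x] y)"
proof -
  have fin: "finite (program f)" "finite (set (input_list x))"
    by (simp_all add: program_def)
  obtain t where t: "t 0 = set (input_list x)" "\<And>n. chase_step (program f) (t n) (t (Suc n))"
    using chase_sequence_exists [OF fin] by blast
  show ?thesis
    unfolding core_chase_terminates_iff [OF fin t]
  proof
    assume "\<exists>y. computes f [x] y"
    then obtain y where y: "computes f [x] y" ..
    define U where "U = (\<Union>n. t n)"
    have U: "active_triggers (program f) U = {}"
      unfolding U_def by (rule chase_limit_model) (rule t(2))
    have inp: "set (input_list x) \<subseteq> U" using t(1) by (auto simp: U_def)
    define nxt where "nxt v = (SOME w. at RSuc [v, w] \<in> U \<and> at RNum [w] \<in> U)" for v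
    have nxt: "at RSuc [v, nxt v] \<in> U \<and> at RNum [nxt v] \<in> U" if "at RNum [v] \<in> U" for v
      unfolding nxt_def by (rule someI_ex) (rule model_suc [OF U that])
    \<comment> \<open>Up to x numbers stand for their constants, so that facts about them are facts
      of the full structure. Beyond x they are interpreted by witnesses of the successor rule, which
      may be nulls and need not be distinct.\<close>
    define e where "e n = (if n \<le> x then Const n else (nxt ^^ (n - x)) (Const x))" for n
    have num: "at RNum [e n] \<in> U" for n
    proof -
      have "at RNum [(nxt ^^ k) (Const x)] \<in> U" for k
        by (induction k) (use inp in_input_list(1) nxt in auto)
      moreover have "at RNum [Const n] \<in> U" if "n \<le> x"
        using inp that in_input_list(1) by blast
      ultimately show ?thesis by (simp add: e_def)
    qed
    have suc: "at RSuc [e n, e (Suc n)] \<in> U" for n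
    proof (cases "n < x")
      case True
      then show ?thesis using inp in_input_list(3) by (auto simp: e_def)
    next
      case False
      then have "e (Suc n) = nxt (e n)" by (auto simp: e_def Suc_diff_le)
      then show ?thesis using nxt [OF num] by simp
    qed
    define T where "T s ns \<longleftrightarrow> at s (map e ns) \<in> U" for s ns
    have "closed_under T r" if "r \<in> set (rules f)" for r
      unfolding T_def by (rule model_closed_under [OF U that]) (simp add: e_def)
    moreover have "T RDom [n]" if "n \<le> x" for n
      using inp that in_input_list(2) by (auto simp: T_def e_def)
    moreover have "T RIn [x]"
      using inp in_input_list(4) by (auto simp: T_def e_def)
    ultimately have full: "T s ns" if "full_fact f x s ns" for s ns
      using full_derivable [of f T x y] that y num suc by (simp add: T_def)
    have "fact_structure (full_fact f x) \<subseteq> U"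
    proof
      fix a assume "a \<in> fact_structure (full_fact f x)"
      then obtain s ns where a: "a = at s (map Const ns)" "full_fact f x s ns"
        by (auto simp: fact_structure_def)
      then have "map Const ns = map e ns" by (auto simp: full_fact_def e_def)
      then show "a \<in> U" using full [OF a(2)] a(1) unfolding T_def by (simp only:)
    qed
    \<comment> \<open>Only finitely many facts are at stake, so they are all present at some stage,
      and inclusion is the homomorphism from the full structure to it.\<close>
    then obtain n where "fact_structure (full_fact f x) \<subseteq> t n"
      using finite_subset_incseq_UN [of t, OF chase_step_incr [OF t(2)] finite_full] U_def by blast
    moreover have "set (input_list x) \<subseteq> fact_structure (full_fact f x)"
      by (rule input_list_subset) (auto simp: full_fact_def)
    moreover have "active_triggers (program f) (fact_structure (full_fact f x)) = {}"
    proof (rule structure_model [OF full_fact_closed_under])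
      show "\<exists>m. full_fact f x RSuc [n, m] \<and> full_fact f x RNum [m]" if "full_fact f x RNum [n]" for n
        using that by (intro exI [of _ n]) (simp add: full_fact_def)
    qed
    ultimately show "\<exists>n M. finite M \<and> active_triggers (program f) M = {} \<and>
        maps_to (set (input_list x)) M \<and> maps_to M (t n)"
      by (intro exI [of _ n] exI [of _ "fact_structure (full_fact f x)"] conjI finite_full maps_to_subset)
  next
    assume "\<exists>n M. finite M \<and> active_triggers (program f) M = {} \<and>
      maps_to (set (input_list x)) M \<and> maps_to M (t n)"
    then obtain n M h where M: "finite M" "active_triggers (program f) M = {}"
      "chom h (set (input_list x)) M" "maps_to M (t n)"
      by (auto simp: maps_to_def)
    show "\<exists>y. computes f [x] y"
    proof (rule ccontr)
      assume diverges: "\<nexists>y. computes f [x] y"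
      let ?N = "fact_structure (true_fact x)"
      have N: "active_triggers (program f) ?N = {}"
        by (rule structure_model [OF true_fact_closed_under [OF _ diverges]]) auto
      have "maps_to (t n) ?N" for n
      proof (induction n)
        case 0
        show ?case unfolding t(1) by (intro maps_to_subset input_list_subset) auto
      next
        case (Suc n)
        then show ?case
          using retract_step_maps_to_model [OF retract_step_if_chase_step [OF t(2)]] N by blast
      qed
      then obtain g where g: "chom g M ?N"
        using M(4) maps_to_trans unfolding maps_to_def by blast
      define nxt where "nxt v = (SOME w. at RSuc [v, w] \<in> M \<and> at RNum [w] \<in> M)" for v
      have nxt: "at RSuc [v, nxt v] \<in> M \<and> at RNum [nxt v] \<in> M" if "at RNum [v] \<in> M" for v
        unfolding nxt_def by (rule someI_ex) (rule model_suc [OF M(2) that])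
      define e where "e k = (nxt ^^ k) (Const 0)" for k
      have num: "at RNum [e k] \<in> M" for k
      proof (induction k)
        case 0
        have "map_atom h (at RNum [Const 0]) \<in> M"
          using M(3) in_input_list(1) [of 0 x] unfolding chom_def by blast
        then show ?case using M(3) by (simp add: e_def chom_def)
      next
        case (Suc k)
        then show ?case using nxt by (simp add: e_def)
      qed
      \<comment> \<open>Homomorphisms fix \<open>Const 0\<close>, and successors in the standard
        model are unique, so \<open>g\<close> is determined on the chain. Its values there are
        pairwise distinct, so the chain in the finite \<open>M\<close> could not repeat.\<close>
      have "g (e k) = Const k" for k
      proof (induction k)
        case 0
        show ?case using g by (simp add: e_def chom_def)
      next
        case (Suc k)
        have "at RSuc [e k, e (Suc k)] \<in> M" using nxt [OF num] by (simp add: e_def)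
        then have "map_atom g (at RSuc [e k, e (Suc k)]) \<in> ?N"
          using g unfolding chom_def by blast
        then show ?case using Suc by (auto simp: fact_structure_def)
      qed
      then have "inj e" by (metis injI val.inject(1))
      moreover have "range e \<subseteq> vals M"
        using num by (force simp: vals_def)
      ultimately show False
        using finite_vals [OF M(1)] finite_subset finite_imageD infinite_UNIV_nat by metis
    qed
  qed
qed

section \<open>Computability and correctness of the reduction\<close>

lemma computable_input_list [computable_intros]:
  assumes "computable g"
  shows "computable (\<lambda>x. input_list (g x))"
  by (rule computable_comp [OF _ assms]) (unfold input_list_def, intro computable_intros)

text \<open>The tgds do not depend on x, so their code is a constant. The code of a finite set is
  the sum of 2^i over its members i, and as the listed facts are distinct, this is a sum over the
  list.\<close>

lemma computable_input_encode_program: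
  "computable (\<lambda>x. input_encode (set (input_list x), program f))"
proof -
  have "set_encode (atom_encode val_encode ` set (input_list x)) =
      sum_list (map (\<lambda>a. 2 ^ enc a) (input_list x))" for x
  proof -
    have "set_encode (enc ` set (input_list x)) = (\<Sum>a\<in>set (input_list x). 2 ^ enc a)"
      by (simp add: set_encode_def sum.reindex inj_on_def)
    then show ?thesis
      by (simp add: enc_atom_def enc_val_def sum.distinct_set_conv_list [OF distinct_input_list])
  qed
  then have "input_encode (set (input_list x), program f) =
      enc (sum_list (map (\<lambda>a. 2 ^ enc a) (input_list x)) :: nat, set_encode (tgd_encode ` program f))" for x
    by (simp add: input_encode_def)
  then show ?thesis by (simp only:) (intro computable_intros)
qed

definition program_schema :: "recf \<Rightarrow> nat \<rightharpoonup> nat" where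
  "program_schema f = (\<lambda>r. if r \<in> to_nat ` set (syms f) then Some (arity (from_nat r)) else None)"

lemma atom_over_program_schema:
  "s \<in> set (syms f) \<Longrightarrow> length ts = arity s \<Longrightarrow> atom_over (program_schema f) (at s ts)"
  by (simp add: atom_over_def program_schema_def)

lemma schema_program_schema: "schema (program_schema f)"
proof -
  have "0 < arity s" for s by (cases s) simp_all
  moreover have "dom (program_schema f) \<subseteq> to_nat ` set (syms f)"
    by (auto simp: program_schema_def split: if_splits)
  ultimately show ?thesis
    unfolding schema_def
    by (auto simp: ran_def program_schema_def split: if_splits intro: finite_subset)
qed

lemma instance_over_program_schema: "instance_over (program_schema f) (set (input_list x))"
  by (auto simp: instance_over_def input_list_def intro!: atom_over_program_schema)

lemma tgd_over_program_schema:
  assumes "\<xi> \<in> program f"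
  shows "tgd_over (program_schema f) \<xi>"
proof -
  consider "\<xi> = suc_tgd" | r where "r \<in> set (rules f)" "\<xi> = tgd_of_rule r"
    using assms by (auto simp: program_def)
  then show ?thesis
  proof cases
    case 1
    then show ?thesis
      by (auto simp: tgd_over_def suc_tgd_def intro!: atom_over_program_schema)
  next
    case 2
    then show ?thesis using rule_ok_rules [OF 2(1)]
      by (auto simp: tgd_over_def rule_ok_def literal_ok_def intro!: atom_over_program_schema)
  qed
qed

text \<open>By \<open>inj_on_input_encode\<close> the code determines the instance and the tgds, so
  membership, whichever schema witnesses it, is about this very chase.\<close>

lemma input_encode_program_in_membership_iff:
  "input_encode (set (input_list x), program f) \<in> CT_core_membership \<longleftrightarrow> (\<exists>y. computes f [x] y)"
proof -
  have fin: "finite (program f)" by (simp add: program_def)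
  have "input_encode (set (input_list x), program f) \<in> CT_core_membership \<longleftrightarrow>
      core_chase_terminates (program f) (set (input_list x))"
  proof
    assume "input_encode (set (input_list x), program f) \<in> CT_core_membership"
    then obtain S I \<Sigma> where I: "input_encode (set (input_list x), program f) = input_encode (I, \<Sigma>)"
      "instance_over S I" "\<Sigma> \<in> CT_core S I"
      by (auto simp: CT_core_membership_def)
    then have "(set (input_list x), program f) = (I, \<Sigma>)"
      using fin by (intro inj_onD [OF inj_on_input_encode]) (auto simp: instance_over_def CT_core_def)
    then show "core_chase_terminates (program f) (set (input_list x))"
      using I(3) by (simp add: CT_core_def)
  next
    assume "core_chase_terminates (program f) (set (input_list x))"
    then have "program f \<in> CT_core (program_schema f) (set (input_list x))"
      using fin tgd_over_program_schema by (simp add: CT_core_def)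
    then show "input_encode (set (input_list x), program f) \<in> CT_core_membership"
      unfolding CT_core_membership_def
      using schema_program_schema instance_over_program_schema by blast
  qed
  then show ?thesis by (simp add: program_terminates_iff)
qed

theorem corollary2: "RE_complete CT_core_membership"
  unfolding RE_complete_def
proof (intro conjI allI impI)
  show "recursively_enumerable CT_core_membership"
    by (rule recursively_enumerable_CT_core_membership)
  fix B assume "recursively_enumerable B"
  then obtain f where "B = {x. \<exists>y. computes f [x] y}"
    by (auto simp: recursively_enumerable_def)
  then show "many_one_reducible B CT_core_membership"
    unfolding many_one_reducible_def
    using total_recursive_if_computable [OF computable_input_encode_program]
      input_encode_program_in_membership_iff
    by (intro exI [of _ "\<lambda>x. input_encode (set (input_list x), program f)"]) simp
qed

end
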